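(* Let $\alpha>0$, $n\ge 0$ an integer and $s>0$. With $X_n(t):=t/a_n(t)$, $$\ln\frac{D_n(s)}{D_n(0)}=\int_{0}^{s}\left[\frac{t}{2}-\frac14\left(\frac{t}{a_n}-\alpha\right)^2-a_n\left(n+\frac{\alpha}{2}\right)-\frac{a_n^2}{4}+\frac14\left(1-\frac{t\,a_n'}{a_n}\right)^2\right]\frac{dt}{t}$$ $$=\int_{0}^{s}\left[\frac{t}{2}-\frac14(X_n-\alpha)^2-\left(n+\frac{\alpha}{2}\right)\frac{t}{X_n}-\frac{t^2}{4X_n^2}+\frac{t^2(X_n')^2}{4X_n^2}\right]\frac{dt}{t},$$ where $a_n=a_n(t)$, $X_n=X_n(t)$ and primes denote $d/dt$.
   Context: Fix $\alpha>0$. For $s\ge 0$ let $w(x,s)=x^{\alpha}e^{-x-s/x}$ on $(0,\infty)$ (so $w(x,0)=x^\alpha e^{-x}$). Let $P_n(x)=P_n(x,s)$, $n\ge0$, be the monic polynomials of degree $n$ with $\int_0^\infty P_jP_k\,w(x,s)\,dx=h_j(s)\delta_{jk}$. Define $$a_n(s):=\frac{s}{h_n(s)}\int_0^\infty\frac{P_n(y,s)^2}{y}\,w(y,s)\,dy ,$$ and the Hankel determinant $$D_n(s)=\det\left(\int_0^\infty x^{j+k}w(x,s)\,dx\right)_{j,k=0}^{n-1}=\prod_{j=0}^{n-1}h_j(s),\qquad D_0=1 .$$ *)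

theory Defs
  imports
    "HOL-Analysis.Analysis"
    "HOL-Computational_Algebra.Polynomial"
    "Jordan_Normal_Form.Determinant"
begin

definition weight :: "real \<Rightarrow> real \<Rightarrow> real \<Rightarrow> real" where
  "weight \<alpha> s x = x powr \<alpha> * exp (- x - s / x)"

definition monic_orthogonal :: "real \<Rightarrow> real \<Rightarrow> (nat \<Rightarrow> real poly) \<Rightarrow> bool" where
  "monic_orthogonal \<alpha> s P \<longleftrightarrow>
     (\<forall>n. degree (P n) = n \<and> lead_coeff (P n) = 1) \<and>
     (\<forall>j k. j \<noteq> k \<longrightarrow>
        (LBINT x:{0<..}. poly (P j) x * poly (P k) x * weight \<alpha> s x) = 0)"

text \<open>For \<open>\<alpha> > 0\<close> and \<open>s \<ge> 0\<close> all moments are finite and the weight is positive on the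
  half-line, so exactly one such sequence exists.\<close>

definition orth_poly :: "real \<Rightarrow> real \<Rightarrow> nat \<Rightarrow> real poly" where
  "orth_poly \<alpha> s = (THE P. monic_orthogonal \<alpha> s P)"

definition sq_norm :: "real \<Rightarrow> nat \<Rightarrow> real \<Rightarrow> real" where
  "sq_norm \<alpha> n s = (LBINT x:{0<..}. (poly (orth_poly \<alpha> s n) x)\<^sup>2 * weight \<alpha> s x)"

definition a_coeff :: "real \<Rightarrow> nat \<Rightarrow> real \<Rightarrow> real" where
  "a_coeff \<alpha> n s =
     s / sq_norm \<alpha> n s *
       (LBINT y:{0<..}. (poly (orth_poly \<alpha> s n) y)\<^sup>2 / y * weight \<alpha> s y)"

definition X_fun :: "real \<Rightarrow> nat \<Rightarrow> real \<Rightarrow> real" where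
  "X_fun \<alpha> n t = t / a_coeff \<alpha> n t"

text \<open>\<open>HOL-Analysis\<close> has a \<open>det\<close> of its own whose dimension is a type; the one used here has
  a numeric dimension, and value 1 on the empty matrix.\<close>

definition hankel_det :: "real \<Rightarrow> nat \<Rightarrow> real \<Rightarrow> real" where
  "hankel_det \<alpha> n s =
     Determinant.det (Matrix.mat n n
       (\<lambda>(j, k). LBINT x:{0<..}. x ^ (j + k) * weight \<alpha> s x))"

end

theory Submission imports Defs "HOL-Real_Asymp.Real_Asymp" begin

hide_const (open) Module.smult

text \<open>Let \<open>L(f) = \<integral> f w dx\<close>. Since \<open>w' = (-1 + \<alpha>/x + s/x\<^sup>2) w\<close>, Pearson's identity
  \<open>L(f) = L(f') + \<alpha> L(f/x) + s L(f/x\<^sup>2)\<close> holds for Laurent polynomials \<open>f\<close>. Put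
  \<open>b\<^sub>n = s L(P\<^sub>n P\<^sub>n\<^sub>-\<^sub>1/x) / h\<^sub>n\<^sub>-\<^sub>1\<close> and let \<open>\<alpha>\<^sub>n\<close>, \<open>\<beta>\<^sub>n\<close> be the coefficients of the three-term
  recurrence. Choosing \<open>f\<close> among \<open>x P\<^sub>n\<^sup>2\<close>, \<open>x P\<^sub>n P\<^sub>n\<^sub>-\<^sub>1\<close>, \<open>P\<^sub>n\<^sup>2\<close>, \<open>P\<^sub>n P\<^sub>n\<^sub>-\<^sub>1\<close> gives
  \<open>\<alpha>\<^sub>n = 2n + 1 + \<alpha> + a\<^sub>n\<close>, \<open>\<Sum>\<^bsub>j<n\<^esub> a\<^sub>j = \<beta>\<^sub>n - b\<^sub>n - n(n + \<alpha>)\<close>,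
  \<open>\<beta>\<^sub>n (a\<^sub>n + a\<^sub>n\<^sub>-\<^sub>1) = n s - (2n + \<alpha>) b\<^sub>n\<close> and \<open>b\<^sub>n (b\<^sub>n - s) = \<beta>\<^sub>n a\<^sub>n a\<^sub>n\<^sub>-\<^sub>1\<close>. As \<open>\<partial>w/\<partial>s = -w/x\<close>, one has
  \<open>s h\<^sub>n' = -a\<^sub>n h\<^sub>n\<close> and, from the second highest coefficient of \<open>P\<^sub>n\<close>, \<open>s a\<^sub>n' = b\<^sub>n - b\<^sub>n\<^sub>+\<^sub>1 = 2 b\<^sub>n - s + \<alpha>\<^sub>n a\<^sub>n\<close>.
  Eliminating \<open>b\<^sub>n\<close> and \<open>\<beta>\<^sub>n\<close> turns the bracket in the integrand into
  \<open>-\<Sum>\<^bsub>j<n\<^esub> a\<^sub>j = s (ln D\<^sub>n)'\<close>. This has constant sign and \<open>D\<^sub>n\<close> is continuous at \<open>0\<close>, so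
  integrability and the formula follow from the fundamental theorem of calculus.\<close>

subsection \<open>Moments of the weight\<close>

lemma borel_measurable_weight [measurable]: "weight r s \<in> borel_measurable borel"
  unfolding weight_def[abs_def] by measurable

lemma weight_nonneg: "weight r s x \<ge> 0"
  by (simp add: weight_def)

lemma weight_eq: "weight r s x = x powr r * exp (- x) * exp (- (s / x))"
  by (simp add: weight_def exp_diff exp_minus field_simps)

lemma weight_pos: "x > 0 \<Longrightarrow> weight r s x > 0"
  by (simp add: weight_def)

lemma mult_weight: "x > 0 \<Longrightarrow> x * weight r s x = weight (r + 1) s x"
  by (simp add: weight_def powr_add mult_ac)

lemma power_mult_weight: "x > 0 \<Longrightarrow> x ^ k * weight r s x = weight (r + real k) s x"
  by (simp add: weight_def powr_add powr_realpow mult_ac)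

lemma weight_divide: "x > 0 \<Longrightarrow> weight r s x / x = weight (r - 1) s x"
  by (simp add: weight_def powr_diff field_simps)

lemma set_integrable_weight_0:
  assumes "r > -1" shows "set_integrable lborel {0<..} (weight r 0)"
proof -
  have "integrable lborel (\<lambda>t. indicator {0..} t * t powr r / exp t)"
  proof (rule integrableI_nonneg)
    have "(\<integral>\<^sup>+ t. ennreal (indicator {0..} t * t powr (r + 1 - 1) / exp t) \<partial>lborel) = ennreal (Gamma (r + 1))"
      using Gamma_conv_nn_integral_real[of "r + 1"] assms by simp
    then show "(\<integral>\<^sup>+ t. ennreal (indicator {0..} t * t powr r / exp t) \<partial>lborel) < \<infinity>" by simp
  qed auto
  moreover have "indicator {0..} t * t powr r / exp t = indicator {0<..} t *\<^sub>R weight r 0 t" for t :: real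
    by (cases "t = 0") (auto simp: weight_def indicator_def exp_minus field_simps)
  ultimately show ?thesis unfolding set_integrable_def by simp
qed

text \<open>A single term of the exponential series bounds \<open>exp y\<close> from below. With
  \<open>y = s / x\<close> this trades the factor \<open>exp (- (s / x))\<close> for any chosen
  power of x.\<close>

lemma exp_minus_le_fact_div_power:
  fixes y :: real assumes "y > 0" shows "exp (- y) \<le> fact k / y ^ k"
proof -
  have "y ^ k / fact k \<le> exp y"
    using sum_le_suminf[OF summable_exp, of "{k}" y] assms by (simp add: exp_def field_simps)
  then show ?thesis using assms by (simp add: exp_minus field_simps)
qed

text \<open>The factor \<open>exp (- (s / x))\<close> beats every negative power of x at the origin,
  so \<open>r\<close> is arbitrary: \<open>k\<close> raises the exponent above -1, where the weight
  at s = 0 dominates.\<close>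

lemma set_integrable_weight:
  assumes "s > 0" shows "set_integrable lborel {0<..} (weight r s)"
proof -
  obtain k :: nat where "- 1 - r < real k" using reals_Archimedean2 by blast
  then have k: "r + real k > -1" by linarith
  have bound: "weight r s x \<le> fact k / s ^ k * weight (r + real k) 0 x" if "x > 0" for x
  proof -
    have "exp (- (s / x)) \<le> fact k / (s / x) ^ k"
      using exp_minus_le_fact_div_power that assms by simp
    also have "\<dots> = fact k / s ^ k * x ^ k" by (simp add: field_simps)
    finally have "x powr r * exp (- x) * exp (- (s / x)) \<le> x powr r * exp (- x) * (fact k / s ^ k * x ^ k)"
      by (intro mult_left_mono) auto
    then show ?thesis using that
      by (simp add: weight_eq powr_add powr_realpow mult_ac)
  qed
  show ?thesis
  proof (rule set_integrable_bound)
    show "set_integrable lborel {0<..} (\<lambda>x. fact k / s ^ k * weight (r + real k) 0 x)"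
      using set_integrable_weight_0[OF k] by simp
    show "set_borel_measurable lborel {0<..} (weight r s)"
      unfolding set_borel_measurable_def by measurable
    show "AE x in lborel. x \<in> {0<..} \<longrightarrow> norm (weight r s x) \<le> norm (fact k / s ^ k * weight (r + real k) 0 x)"
      using bound assms by (auto simp: abs_mult weight_nonneg)
  qed
qed

text \<open>A real exponent makes division of the integrand by x a shift of \<open>r\<close>. For s
  > 0 the value is \<open>2 * s^((r+1)/2) * K_(r+1)(2 * sqrt s)\<close>, with K the modified Bessel
  function of the second kind.\<close>

definition moment :: "real \<Rightarrow> real \<Rightarrow> real" where
  "moment r s = (LBINT x:{0<..}. weight r s x)"

definition weight_integrable :: "real \<Rightarrow> real \<Rightarrow> bool" where
  "weight_integrable r s \<longleftrightarrow> s > 0 \<or> s = 0 \<and> r > -1"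

lemma set_integrable_weight_if_weight_integrable: "weight_integrable r s \<Longrightarrow> set_integrable lborel {0<..} (weight r s)"
  unfolding weight_integrable_def using set_integrable_weight set_integrable_weight_0 by auto

text \<open>With d = b - a the left side is \<open>exp (- a) * (exp (- d) - 1 + d)\<close>. The
  inequality \<open>1 + y \<le> exp y\<close> at y = -d and y = d puts the second factor between 0
  and \<open>d * (1 - exp (- d))\<close>; the sign of d decides which end point dominates.\<close>

lemma exp_second_order_bound:
  fixes a b :: real
  shows "\<bar>exp (- b) - exp (- a) + (b - a) * exp (- a)\<bar> \<le> (b - a)\<^sup>2 * exp (- min a b)"
proof -
  define d where "d = b - a"
  have e1: "exp (- d) \<ge> 1 - d" using exp_ge_add_one_self[of "-d"] by simp
  have lo: "0 \<le> exp (- d) - 1 + d" using e1 by simp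
  have e2: "exp (-d) * (1 + d) \<le> 1"
    using mult_left_mono[OF exp_ge_add_one_self[of d], of "exp (-d)"] by (simp flip: exp_add)
  then have up: "exp (- d) - 1 + d \<le> d * (1 - exp (- d))" by (simp add: algebra_simps)
  have eq: "exp (- b) - exp (- a) + (b - a) * exp (- a) = exp (- a) * (exp (- d) - 1 + d)"
    unfolding d_def by (simp add: algebra_simps flip: exp_add)
  have "exp (- a) * (exp (- d) - 1 + d) \<le> d\<^sup>2 * exp (- min a b)"
  proof (cases "d \<ge> 0")
    case True
    have "d * (1 - exp (- d)) \<le> d * d" using True e1 by (intro mult_left_mono) auto
    then have "exp (- d) - 1 + d \<le> d\<^sup>2" using up by (simp add: power2_eq_square)
    then have "exp (- a) * (exp (- d) - 1 + d) \<le> exp (- a) * d\<^sup>2" by (intro mult_left_mono) auto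
    also have "\<dots> = d\<^sup>2 * exp (- min a b)" using True by (simp add: d_def min_def)
    finally show ?thesis .
  next
    case False
    have "1 - exp (- d) \<ge> d * exp (- d)" using e2 by (simp add: algebra_simps)
    then have "d * (1 - exp (- d)) \<le> d * (d * exp (- d))" using False by (intro mult_left_mono_neg) auto
    then have "exp (- d) - 1 + d \<le> d\<^sup>2 * exp (- d)" using up by (simp add: power2_eq_square mult_ac)
    then have "exp (- a) * (exp (- d) - 1 + d) \<le> exp (- a) * (d\<^sup>2 * exp (- d))" by (intro mult_left_mono) auto
    also have "\<dots> = d\<^sup>2 * (exp (- a) * exp (- d))" by simp
    also have "\<dots> = d\<^sup>2 * exp (- min a b)" using False by (simp add: d_def min_def flip: exp_add)
    finally show ?thesis .
  qed
  moreover have "exp (- a) * (exp (- d) - 1 + d) \<ge> 0" using lo by simp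
  ultimately show ?thesis using eq by (simp add: d_def)
qed

text \<open>Staying above s/2 gives a dominating weight that does not depend on t. The square of
  \<open>t / x - s / x\<close> costs two powers of x, hence the exponent
  \<open>r - 2\<close>.\<close>

lemma moment_second_order:
  assumes s: "s > 0" and t: "t > s / 2"
  shows "\<bar>moment r t - moment r s + (t - s) * moment (r - 1) s\<bar> \<le> (t - s)\<^sup>2 * moment (r - 2) (s / 2)"
proof -
  let ?I = "\<lambda>f. (LBINT x:{0<..}. f x :: real)"
  have t0: "t > 0" "s / 2 > 0" using s t by simp_all
  note int = set_integrable_weight[OF s] set_integrable_weight[OF t0(1)] set_integrable_weight[OF t0(2)]
  let ?g = "\<lambda>x. weight r t x - weight r s x + (t - s) * weight (r - 1) s x"
  have intg: "set_integrable lborel {0<..} ?g"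
    by (intro set_integral_add set_integral_diff set_integrable_mult_right int)
  have "moment r t - moment r s + (t - s) * moment (r - 1) s = ?I ?g"
    unfolding moment_def
    by (subst set_integral_add; (subst set_integral_diff)?; (intro set_integral_diff set_integrable_mult_right int)?; simp)
  moreover have "\<bar>?I ?g\<bar> \<le> ?I (\<lambda>x. \<bar>?g x\<bar>)"
    using set_integral_norm_bound[OF intg] by simp
  moreover have "?I (\<lambda>x. \<bar>?g x\<bar>) \<le> ?I (\<lambda>x. (t - s)\<^sup>2 * weight (r - 2) (s / 2) x)"
  proof (rule set_integral_mono)
    show "set_integrable lborel {0<..} (\<lambda>x. \<bar>?g x\<bar>)"
      using set_integrable_abs[OF intg] by simp
    show "set_integrable lborel {0<..} (\<lambda>x. (t - s)\<^sup>2 * weight (r - 2) (s / 2) x)"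
      by (intro set_integrable_mult_right int)
    fix x :: real assume "x \<in> {0<..}"
    then have x: "x > 0" by simp
    have "?g x = x powr r * exp (- x) * (exp (- (t / x)) - exp (- (s / x)) + (t / x - s / x) * exp (- (s / x)))"
      using x by (simp add: weight_eq powr_diff field_simps)
    then have "\<bar>?g x\<bar> = x powr r * exp (- x) * \<bar>exp (- (t / x)) - exp (- (s / x)) + (t / x - s / x) * exp (- (s / x))\<bar>"
      by (simp add: abs_mult)
    also have "\<dots> \<le> x powr r * exp (- x) * ((t / x - s / x)\<^sup>2 * exp (- min (s / x) (t / x)))"
      by (intro mult_left_mono exp_second_order_bound) auto
    also have "\<dots> \<le> x powr r * exp (- x) * ((t / x - s / x)\<^sup>2 * exp (- (s / 2 / x)))"
      using x s t by (intro mult_left_mono) (auto simp: min_def divide_simps)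
    also have "\<dots> = (t - s)\<^sup>2 * weight (r - 2) (s / 2) x"
      using x by (simp add: weight_eq powr_diff field_simps power2_eq_square powr_numeral)
    finally show "\<bar>?g x\<bar> \<le> (t - s)\<^sup>2 * weight (r - 2) (s / 2) x" .
  qed
  ultimately show ?thesis by (simp add: moment_def)
qed

lemma has_real_derivative_moment:
  assumes s: "s > 0"
  shows "(moment r has_real_derivative - moment (r - 1) s) (at s)"
proof -
  have "((\<lambda>t. (moment r t - moment r s) / (t - s) - - moment (r - 1) s) \<longlongrightarrow> 0) (at s)"
  proof (rule Lim_null_comparison)
    show "((\<lambda>t. \<bar>t - s\<bar> * moment (r - 2) (s / 2)) \<longlongrightarrow> 0) (at s)"
      by (rule tendsto_eq_intros refl | simp)+
    have "\<forall>\<^sub>F t in at s. t > s / 2"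
      using s by (intro order_tendstoD(1)[OF tendsto_ident_at]) auto
    moreover have "\<forall>\<^sub>F t in at s. t \<noteq> s" by (simp add: eventually_at_filter)
    ultimately show "\<forall>\<^sub>F t in at s. norm ((moment r t - moment r s) / (t - s) - - moment (r - 1) s)
        \<le> \<bar>t - s\<bar> * moment (r - 2) (s / 2)"
    proof eventually_elim
      case (elim t)
      have "(moment r t - moment r s) / (t - s) - - moment (r - 1) s
          = (moment r t - moment r s + (t - s) * moment (r - 1) s) / (t - s)"
        using elim by (simp add: field_simps)
      also have "\<bar>\<dots>\<bar> = \<bar>moment r t - moment r s + (t - s) * moment (r - 1) s\<bar> / \<bar>t - s\<bar>" by simp
      also have "\<dots> \<le> ((t - s)\<^sup>2 * moment (r - 2) (s / 2)) / \<bar>t - s\<bar>"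
        using moment_second_order[OF s elim(1)] by (intro divide_right_mono) auto
      also have "\<dots> = \<bar>t - s\<bar> * moment (r - 2) (s / 2)"
      proof -
        have "x * m / e = e * m" if "x = e * e" "e > 0" for x m e :: real
          using that by simp
        from this[of "(t - s)\<^sup>2" "\<bar>t - s\<bar>"] elim show ?thesis by (simp add: power2_eq_square)
      qed
      finally show ?case by simp
    qed
  qed
  then show ?thesis unfolding has_field_derivative_iff by (rule LIM_zero_cancel)
qed

text \<open>The estimate \<open>1 - exp (- (t / x)) \<le> t / x\<close> costs one power of x, and
  \<open>r > 0\<close> keeps the resulting weight of exponent \<open>r - 1\<close> integrable at s =
  0.\<close>

lemma moment_tendsto_0:
  assumes r: "r > 0"
  shows "(moment r \<longlongrightarrow> moment r 0) (at_right 0)"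
proof -
  have "((\<lambda>t. moment r t - moment r 0) \<longlongrightarrow> 0) (at_right 0)"
  proof (rule Lim_null_comparison)
    show "((\<lambda>t. t * moment (r - 1) 0) \<longlongrightarrow> 0) (at_right 0)"
      by (rule tendsto_eq_intros refl | simp)+
    have "\<forall>\<^sub>F t in at_right 0. (t::real) > 0" by (simp add: eventually_at_right_less)
    then show "\<forall>\<^sub>F t in at_right 0. norm (moment r t - moment r 0) \<le> t * moment (r - 1) 0"
    proof eventually_elim
      case (elim t)
      have i: "set_integrable lborel {0<..} (weight r t)" "set_integrable lborel {0<..} (weight r 0)"
         "set_integrable lborel {0<..} (weight (r - 1) 0)"
        using elim r by (auto intro: set_integrable_weight set_integrable_weight_0)
      have id: "set_integrable lborel {0<..} (\<lambda>x. weight r t x - weight r 0 x)"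
        by (intro set_integral_diff i)
      have "norm (moment r t - moment r 0) = norm (LBINT x:{0<..}. weight r t x - weight r 0 x)"
        unfolding moment_def using set_integral_diff(2)[OF i(1,2)] by simp
      also have "\<dots> \<le> (LBINT x:{0<..}. norm (weight r t x - weight r 0 x))"
        by (rule set_integral_norm_bound[OF id])
      also have "\<dots> \<le> (LBINT x:{0<..}. t * weight (r - 1) 0 x)"
      proof (rule set_integral_mono)
        fix x :: real assume "x \<in> {0<..}"
        then have x: "x > 0" by simp
        have "weight r 0 x - weight r t x = x powr r * exp (- x) * (1 - exp (- (t / x)))"
          by (simp add: weight_def exp_diff exp_minus field_simps)
        also have "\<dots> \<le> x powr r * exp (- x) * (t / x)"
          using exp_ge_add_one_self[of "- (t / x)"] by (intro mult_left_mono) auto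
        also have "\<dots> = t * weight (r - 1) 0 x"
          using x by (simp add: weight_def powr_diff)
        finally have "weight r 0 x - weight r t x \<le> t * weight (r - 1) 0 x" .
        moreover have "weight r t x \<le> weight r 0 x"
          using x elim by (auto simp: weight_def intro!: mult_left_mono)
        ultimately show "norm (weight r t x - weight r 0 x) \<le> t * weight (r - 1) 0 x" by simp
      qed (use id i in \<open>auto intro: set_integrable_abs\<close>)
      finally show ?case by (simp add: moment_def)
    qed
  qed
  then show ?thesis by (simp add: LIM_zero_iff)
qed

text \<open>The derivative of the weight integrates to 0 over the half-line: the boundary value at
  infinity vanishes by \<open>exp (- x)\<close>, the one at 0 by \<open>exp (- (s / x))\<close>,
  whatever the sign of \<open>r\<close>.\<close>

lemma moment_pearson:
  assumes s: "s > 0"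
  shows "moment r s = r * moment (r - 1) s + s * moment (r - 2) s"
proof -
  note int = set_integrable_weight[OF s]
  let ?f = "\<lambda>x. r * weight (r - 1) s x + s * weight (r - 2) s x - weight r s x"
  have der: "(weight r s has_real_derivative ?f x) (at x)" if "x > 0" for x
    unfolding weight_def[abs_def] using that
    by (auto intro!: derivative_eq_intros simp: powr_diff powr_numeral field_simps power2_eq_square)
  have ei: "einterval 0 \<infinity> = {0<..}" by (auto simp: einterval_def zero_ereal_def)
  have "(LBINT x=0..\<infinity>. ?f x) = 0 - 0"
  proof (rule interval_integral_FTC_integrable)
    show "(weight r s has_vector_derivative ?f x) (at x)" if "0 < ereal x" for x
      using der that by (simp add: zero_ereal_def has_real_derivative_iff_has_vector_derivative)
    show "isCont ?f x" if "0 < ereal x" for x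
      unfolding weight_def using that by (auto intro!: continuous_intros simp: zero_ereal_def)
    show "set_integrable lborel (einterval 0 \<infinity>) ?f"
      unfolding ei by (intro set_integral_add set_integral_diff set_integrable_mult_right int)
    have "((\<lambda>x. x powr r * exp (- x - s / x)) \<longlongrightarrow> 0) (at_right 0)"
      using s by real_asymp
    then show "((weight r s \<circ> real_of_ereal) \<longlongrightarrow> 0) (at_right 0)"
      unfolding zero_ereal_def ereal_tendsto_simps weight_def .
    have "((\<lambda>x. x powr r * exp (- x - s / x)) \<longlongrightarrow> 0) at_top"
      using s by real_asymp
    then show "((weight r s \<circ> real_of_ereal) \<longlongrightarrow> 0) (at_left \<infinity>)"
      unfolding ereal_tendsto_simps weight_def .
  qed auto
  then have "(LBINT x:{0<..}. ?f x) = 0"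
    by (simp add: interval_lebesgue_integral_def ei)
  moreover have "(LBINT x:{0<..}. ?f x) = r * moment (r - 1) s + s * moment (r - 2) s - moment r s"
    unfolding moment_def using int
    by (simp add: set_integral_add set_integral_diff set_integrable_mult_right)
  ultimately show ?thesis by simp
qed

subsection \<open>Orthogonal polynomials of a positive functional\<close>

text \<open>The three-term recurrence serves as the construction, so orthogonality is what has to be
  proved. The coefficients are rational in values of \<open>L\<close>, which later yields
  differentiability in the parameter by induction.\<close>

fun monic_op :: "(real poly \<Rightarrow> real) \<Rightarrow> nat \<Rightarrow> real poly" where
  "monic_op L 0 = 1"
| "monic_op L (Suc n) = pCons 0 (monic_op L n)
     - smult (L (pCons 0 (monic_op L n * monic_op L n)) / L (monic_op L n * monic_op L n)) (monic_op L n)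
     - smult (if n = 0 then 0 else L (monic_op L n * monic_op L n) / L (monic_op L (n - 1) * monic_op L (n - 1))) (monic_op L (n - 1))"

definition norm_sq :: "(real poly \<Rightarrow> real) \<Rightarrow> nat \<Rightarrow> real" where
  "norm_sq L n = L (monic_op L n * monic_op L n)"

definition rec_alpha :: "(real poly \<Rightarrow> real) \<Rightarrow> nat \<Rightarrow> real" where
  "rec_alpha L n = L (pCons 0 (monic_op L n * monic_op L n)) / norm_sq L n"

text \<open>The value 0 at n = 0 kills the spurious term \<open>monic_op L (0 - 1)\<close>, which is
  \<open>monic_op L 0\<close> and not 0.\<close>

definition rec_beta :: "(real poly \<Rightarrow> real) \<Rightarrow> nat \<Rightarrow> real" where
  "rec_beta L n = (if n = 0 then 0 else norm_sq L n / norm_sq L (n - 1))"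

lemma monic_op_recurrence:
  "pCons 0 (monic_op L n) = monic_op L (Suc n) + smult (rec_alpha L n) (monic_op L n) + smult (rec_beta L n) (monic_op L (n - 1))"
  by (simp add: rec_alpha_def rec_beta_def norm_sq_def)

lemma degree_coeff_monic_op: "degree (monic_op L n) \<le> n \<and> coeff (monic_op L n) n = 1"
proof (induction n rule: less_induct)
  case (less n)
  show ?case
  proof (cases n)
    case 0
    then show ?thesis by simp
  next
    case (Suc m)
    have "m - 1 < n" using Suc by linarith
    then have "degree (monic_op L (m - 1)) \<le> m - 1" using less by blast
    then have 1: "degree (monic_op L m) \<le> m" "coeff (monic_op L m) m = 1" "degree (monic_op L (m - 1)) \<le> m"
      using less[of m] Suc by auto
    have 2: "degree (pCons 0 (monic_op L m)) \<le> Suc m"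
      using 1 by (simp add: degree_pCons_le le_trans)
    have "degree (monic_op L (Suc m)) \<le> Suc m"
      unfolding monic_op.simps
      by (intro degree_diff_le 2 order_trans[OF degree_smult_le]) (use 1 in auto)
    moreover have "coeff (monic_op L (Suc m)) (Suc m) = 1"
      using 1 by (simp add: coeff_eq_0)
    ultimately show ?thesis using Suc by simp
  qed
qed

lemma degree_monic_op [simp]: "degree (monic_op L n) = n"
  using degree_coeff_monic_op[of L n] by (metis le_antisym le_degree one_neq_zero)

lemma coeff_monic_op [simp]: "coeff (monic_op L n) n = 1"
  using degree_coeff_monic_op by blast

lemma coeff_monic_op_eq_0 [simp]: "i > n \<Longrightarrow> coeff (monic_op L n) i = 0"
  by (simp add: coeff_eq_0)

lemma monic_op_nonzero [simp]: "monic_op L n \<noteq> 0"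
  by (metis coeff_monic_op coeff_0 one_neq_zero)

definition monic_sequence :: "(nat \<Rightarrow> real poly) \<Rightarrow> bool" where
  "monic_sequence P \<longleftrightarrow> (\<forall>n. degree (P n) = n \<and> lead_coeff (P n) = 1)"

locale positive_functional =
  fixes L :: "real poly \<Rightarrow> real"
  assumes add: "L (p + q) = L p + L q"
    and smult: "L (smult c p) = c * L p"
    and pos: "p \<noteq> 0 \<Longrightarrow> L (p * p) > 0"
begin

lemma zero [simp]: "L 0 = 0"
  using smult[of 0 0] by simp

lemma diff: "L (p - q) = L p - L q"
  using add[of p "smult (-1) q"] smult[of "-1" q] by simp

lemmas linear = add diff smult

lemma norm_sq_pos: "norm_sq L n > 0"
  unfolding norm_sq_def by (intro pos) simp

text \<open>Induction on the strict degree bound \<open>m\<close>: subtracting a multiple of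
  \<open>P m\<close> removes the top coefficient of \<open>q\<close>. Stating the bound by
  coefficients lets m = 0 mean that \<open>q\<close> is zero.\<close>

lemma orthogonal_lower_degree:
  assumes P: "monic_sequence P" "\<And>j k. j \<noteq> k \<Longrightarrow> L (P j * P k) = 0"
    and "\<And>i. i \<ge> m \<Longrightarrow> coeff q i = 0" "m \<le> n"
  shows "L (P n * q) = 0"
  using assms(3,4)
proof (induction m arbitrary: q)
  case 0
  then have "q = 0" by (auto simp: poly_eq_iff)
  then show ?case by simp
next
  case (Suc m)
  have c: "coeff (P m) m = 1" "\<And>i. i > m \<Longrightarrow> coeff (P m) i = 0"
    using P(1) by (auto simp: monic_sequence_def coeff_eq_0 intro: coeff_eq_0) metis
  let ?q = "q - smult (coeff q m) (P m)"
  have "L (P n * ?q) = 0"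
  proof (rule Suc.IH)
    fix i assume "i \<ge> m"
    then show "coeff ?q i = 0"
      using Suc.prems(1)[of i] c by (cases "i = m") auto
  qed (use Suc.prems in simp)
  moreover have "L (P n * P m) = 0" using P(2) Suc.prems by simp
  ultimately show ?case by (simp add: right_diff_distrib linear)
qed

text \<open>The difference of two candidates has degree below n, so it is orthogonal to both and
  hence to itself; positivity makes it vanish.\<close>

lemma monic_orthogonal_unique:
  assumes P: "monic_sequence P" "\<And>j k. j \<noteq> k \<Longrightarrow> L (P j * P k) = 0"
    and Q: "monic_sequence Q" "\<And>j k. j \<noteq> k \<Longrightarrow> L (Q j * Q k) = 0"
  shows "P = Q"
proof
  fix n
  let ?r = "P n - Q n"
  have c: "coeff ?r i = 0" if "i \<ge> n" for i
    using P(1) Q(1) that unfolding monic_sequence_def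
    by (cases "i = n") (simp_all add: coeff_eq_0, metis)
  have "L (P n * ?r) = 0" "L (Q n * ?r) = 0"
    using orthogonal_lower_degree[OF P c] orthogonal_lower_degree[OF Q c] by auto
  then have "L (?r * ?r) = 0" by (simp add: left_diff_distrib linear)
  then show "P n = Q n" using pos[of ?r] by force
qed

lemma monic_sequence_monic_op: "monic_sequence (monic_op L)"
  by (simp add: monic_sequence_def)

text \<open>Only k = n + 1 is new. After expanding that polynomial, the factor x is moved to the one
  of index j and expanded there; the choice of \<open>rec_alpha\<close> settles j = n, that of
  \<open>rec_beta\<close> settles j + 1 = n, and for smaller j every term vanishes.\<close>

lemma monic_op_orthogonal_aux: "j < k \<Longrightarrow> k \<le> n \<Longrightarrow> L (monic_op L j * monic_op L k) = 0"
proof (induction n arbitrary: j k)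
  case (Suc n)
  note IH = Suc.IH
  have IH': "L (monic_op L k * monic_op L j) = 0" if "j < k" "k \<le> n" for j k
    using IH[OF that] by (simp add: mult.commute)
  have hn: "norm_sq L i \<noteq> 0" for i using norm_sq_pos[of i] by simp
  show ?case
  proof (cases "k = Suc n")
    case False
    then show ?thesis using Suc.prems IH by simp
  next
    case True
    have Pn: "monic_op L (Suc n) = pCons 0 (monic_op L n) - smult (rec_alpha L n) (monic_op L n) - smult (rec_beta L n) (monic_op L (n - 1))"
      using monic_op_recurrence[of L n] by (simp add: algebra_simps)
    have eq: "L (monic_op L j * monic_op L k) = L (pCons 0 (monic_op L j * monic_op L n)) - rec_alpha L n * L (monic_op L j * monic_op L n)
          - rec_beta L n * L (monic_op L j * monic_op L (n - 1))"
      unfolding True Pn by (simp add: right_diff_distrib linear del: monic_op.simps)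
    consider "j = n" | "Suc j = n" | "Suc j < n" using Suc.prems True by linarith
    then show ?thesis
    proof cases
      case 1
      \<comment> \<open>For n = 0 the two indices coincide and orthogonality says nothing; there the
        factor \<open>rec_beta L 0\<close> is 0.\<close>
      have "rec_beta L n * L (monic_op L n * monic_op L (n - 1)) = 0"
        using IH'[of "n - 1" n] by (cases n) (simp_all add: rec_beta_def)
      then show ?thesis using 1 eq hn[of n] by (simp add: rec_alpha_def flip: norm_sq_def)
    next
      case 2
      have "L (pCons 0 (monic_op L j * monic_op L n)) = L (pCons 0 (monic_op L j) * monic_op L n)" by simp
      also have "\<dots> = L (monic_op L n * monic_op L n) + rec_alpha L j * L (monic_op L j * monic_op L n) + rec_beta L j * L (monic_op L (j - 1) * monic_op L n)"
        unfolding monic_op_recurrence[of L j] using 2 by (simp add: distrib_right linear del: monic_op.simps)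
      also have "\<dots> = norm_sq L n" using 2 IH[of j n] IH[of "j - 1" n] by (simp add: norm_sq_def)
      finally show ?thesis using eq 2 IH[of j n] hn[of j] by (auto simp: rec_beta_def norm_sq_def)
    next
      case 3
      have "L (pCons 0 (monic_op L j * monic_op L n)) = L (pCons 0 (monic_op L j) * monic_op L n)" by simp
      also have "\<dots> = L (monic_op L (Suc j) * monic_op L n) + rec_alpha L j * L (monic_op L j * monic_op L n) + rec_beta L j * L (monic_op L (j - 1) * monic_op L n)"
        unfolding monic_op_recurrence[of L j] by (simp add: distrib_right linear del: monic_op.simps)
      also have "\<dots> = 0" using 3 IH[of j n] IH[of "j - 1" n] IH[of "Suc j" n] by simp
      finally show ?thesis using eq 3 IH[of j n] IH[of j "n - 1"] by simp
    qed
  qed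
qed simp

lemma monic_op_orthogonal: "j \<noteq> k \<Longrightarrow> L (monic_op L j * monic_op L k) = 0"
  using monic_op_orthogonal_aux[of j k k] monic_op_orthogonal_aux[of k j j]
  by (cases j k rule: linorder_cases) (auto simp: mult.commute)

text \<open>Subtracting a multiple of \<open>monic_op L n\<close> leaves degree below n, so only the
  top coefficient survives. All evaluations by orthogonality below go through this form.\<close>

lemma monic_op_mult:
  assumes "\<And>i. i > n \<Longrightarrow> coeff q i = 0"
  shows "L (monic_op L n * q) = coeff q n * norm_sq L n"
proof -
  let ?q = "q - smult (coeff q n) (monic_op L n)"
  have "L (monic_op L n * ?q) = 0"
  proof (rule orthogonal_lower_degree[OF monic_sequence_monic_op monic_op_orthogonal])
    show "coeff ?q i = 0" if "i \<ge> n" for i using that assms[of i] by (cases "i = n") auto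
  qed auto
  then show ?thesis by (simp add: right_diff_distrib linear norm_sq_def)
qed

end

subsection \<open>The moment functional\<close>

text \<open>A finite combination of moments is linear without any integrability condition, and
  \<open>r\<close> carries powers of x, negative ones included:
  \<open>moment_fun (r - 1) s p\<close> stands for the functional of p/x.\<close>

definition moment_fun :: "real \<Rightarrow> real \<Rightarrow> real poly \<Rightarrow> real" where
  "moment_fun r s p = (\<Sum>i\<le>degree p. coeff p i * moment (r + real i) s)"

lemma moment_fun_eq_sum:
  "degree p \<le> N \<Longrightarrow> moment_fun r s p = (\<Sum>i\<le>N. coeff p i * moment (r + real i) s)"
  unfolding moment_fun_def by (rule sum.mono_neutral_left) (auto simp: coeff_eq_0)

lemma moment_fun_0 [simp]: "moment_fun r s 0 = 0"
  by (simp add: moment_fun_def)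

lemma moment_fun_add: "moment_fun r s (p + q) = moment_fun r s p + moment_fun r s q"
proof -
  let ?N = "max (degree p) (degree q)"
  show ?thesis
    using moment_fun_eq_sum[of "p + q" ?N r s] moment_fun_eq_sum[of p ?N r s] moment_fun_eq_sum[of q ?N r s] degree_add_le_max[of p q]
    by (simp add: sum.distrib distrib_right)
qed

lemma moment_fun_smult: "moment_fun r s (smult c p) = c * moment_fun r s p"
  using moment_fun_eq_sum[of "smult c p" "degree p" r s] degree_smult_le
  by (simp add: moment_fun_def sum_distrib_left mult_ac)

lemma moment_fun_diff: "moment_fun r s (p - q) = moment_fun r s p - moment_fun r s q"
  using moment_fun_add[of r s p "smult (-1) q"] moment_fun_smult[of r s "-1" q] by simp

lemma moment_fun_double: "moment_fun r s (2 * p) = 2 * moment_fun r s p"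
  by (simp only: mult_2 moment_fun_add)

lemma moment_fun_pCons: "moment_fun r s (pCons a p) = a * moment r s + moment_fun (r + 1) s p"
proof -
  have "moment_fun r s (pCons a p) = (\<Sum>i\<le>Suc (degree p). coeff (pCons a p) i * moment (r + real i) s)"
    by (rule moment_fun_eq_sum) (simp add: degree_pCons_le)
  also have "\<dots> = a * moment r s + moment_fun (r + 1) s p"
    unfolding sum.atMost_Suc_shift moment_fun_def by (simp add: add_ac)
  finally show ?thesis .
qed

text \<open>Induction on the polynomial with \<open>r\<close> free: removing the constant term
  leaves a factor x, which the weight absorbs as exponent \<open>r + 1\<close>.\<close>

lemma set_integral_poly_weight:
  assumes "weight_integrable r s"
  shows "set_integrable lborel {0<..} (\<lambda>x. poly p x * weight r s x)"
    and "(LBINT x:{0<..}. poly p x * weight r s x) = moment_fun r s p"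
proof -
  have "set_integrable lborel {0<..} (\<lambda>x. poly p x * weight r s x) \<and>
      (LBINT x:{0<..}. poly p x * weight r s x) = moment_fun r s p"
    using assms
  proof (induction p arbitrary: r)
    case 0
    then show ?case by (simp add: set_integrable_def set_lebesgue_integral_def)
  next
    case (pCons a p)
    have wi: "weight_integrable (r + 1) s" using pCons.prems by (auto simp: weight_integrable_def)
    have eq: "poly (pCons a p) x * weight r s x = a * weight r s x + poly p x * weight (r + 1) s x"
      if "x \<in> {0<..}" for x
      using mult_weight[of x r s] that by (simp add: algebra_simps)
    have i1: "set_integrable lborel {0<..} (\<lambda>x. a * weight r s x)"
      using set_integrable_weight_if_weight_integrable[OF pCons.prems] by simp
    note i2 = pCons.IH[OF wi]
    have "set_integrable lborel {0<..} (\<lambda>x. poly (pCons a p) x * weight r s x)"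
      using set_integral_add(1)[OF i1 i2[THEN conjunct1]]
      by (subst set_integrable_cong[OF refl refl eq]) auto
    moreover have "(LBINT x:{0<..}. poly (pCons a p) x * weight r s x) =
        (LBINT x:{0<..}. a * weight r s x + poly p x * weight (r + 1) s x)"
      using eq by (intro set_lebesgue_integral_cong) auto
    ultimately show ?case
      using i1 i2 by (simp add: set_integral_add moment_fun_pCons moment_def)
  qed
  then show "set_integrable lborel {0<..} (\<lambda>x. poly p x * weight r s x)"
    and "(LBINT x:{0<..}. poly p x * weight r s x) = moment_fun r s p" by auto
qed

text \<open>If the integral of the nonnegative integrand were 0, \<open>p\<close> would vanish
  almost everywhere on the unit interval, although its roots form a finite set.\<close>

lemma moment_fun_square_pos:
  assumes w: "weight_integrable r s" and p: "p \<noteq> 0"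
  shows "moment_fun r s (p * p) > 0"
proof -
  let ?f = "\<lambda>x. indicator {0<..} x *\<^sub>R (poly (p * p) x * weight r s x)"
  have i: "integrable lborel ?f"
    using set_integral_poly_weight(1)[OF w, of "p * p"] unfolding set_integrable_def .
  have nn: "AE x in lborel. 0 \<le> ?f x"
    by (intro AE_I2) (simp add: weight_nonneg)
  have eq: "moment_fun r s (p * p) = integral\<^sup>L lborel ?f"
    using set_integral_poly_weight(2)[OF w, of "p * p"] unfolding set_lebesgue_integral_def by simp
  have "moment_fun r s (p * p) \<noteq> 0"
  proof
    assume "moment_fun r s (p * p) = 0"
    then have "AE x in lborel. ?f x = 0"
      using integral_nonneg_eq_0_iff_AE[OF i nn] eq by simp
    then have "AE x in lborel. x \<notin> {0<..<1::real} \<or> x \<in> {x. poly p x = 0}"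
      by eventually_elim (use weight_pos[of _ r s] in \<open>force simp: indicator_def\<close>)
    moreover have "AE x in lborel. x \<notin> {x. poly p x = 0}"
      using finite_imp_null_set_lborel[OF poly_roots_finite[OF p]] by (rule AE_not_in)
    ultimately have "AE x in lborel. x \<notin> {0<..<1::real}" by eventually_elim auto
    then have "{0<..<1::real} \<in> null_sets lborel" by (subst (asm) AE_iff_null_sets[symmetric]) auto
    then show False by (simp add: null_sets_def)
  qed
  moreover have "moment_fun r s (p * p) \<ge> 0" unfolding eq by (intro integral_nonneg_AE nn)
  ultimately show ?thesis by simp
qed

lemma positive_functional_moment_fun: "weight_integrable r s \<Longrightarrow> positive_functional (moment_fun r s)"
  by unfold_locales (simp_all add: moment_fun_add moment_fun_smult moment_fun_square_pos)

lemma orth_poly_eq: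
  assumes "weight_integrable \<alpha> s"
  shows "orth_poly \<alpha> s = monic_op (moment_fun \<alpha> s)"
proof -
  interpret positive_functional "moment_fun \<alpha> s" by (rule positive_functional_moment_fun[OF assms])
  have "monic_orthogonal \<alpha> s P \<longleftrightarrow> monic_sequence P \<and> (\<forall>j k. j \<noteq> k \<longrightarrow> moment_fun \<alpha> s (P j * P k) = 0)" for P
    using set_integral_poly_weight(2)[OF assms, of "P _ * P _"]
    by (simp add: monic_orthogonal_def monic_sequence_def)
  then show ?thesis
    unfolding orth_poly_def
    by (intro the_equality) (use monic_sequence_monic_op monic_op_orthogonal monic_orthogonal_unique in auto)
qed

lemma sq_norm_eq: "weight_integrable \<alpha> s \<Longrightarrow> sq_norm \<alpha> n s = norm_sq (moment_fun \<alpha> s) n"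
  using set_integral_poly_weight(2)[of \<alpha> s "monic_op (moment_fun \<alpha> s) n * monic_op (moment_fun \<alpha> s) n"]
  by (simp add: sq_norm_def orth_poly_eq norm_sq_def power2_eq_square)

lemma a_coeff_eq:
  assumes "s > 0"
  shows "a_coeff \<alpha> n s = s / norm_sq (moment_fun \<alpha> s) n * moment_fun (\<alpha> - 1) s (monic_op (moment_fun \<alpha> s) n * monic_op (moment_fun \<alpha> s) n)"
proof -
  have w: "weight_integrable \<alpha> s" "weight_integrable (\<alpha> - 1) s" using assms by (auto simp: weight_integrable_def)
  let ?P = "monic_op (moment_fun \<alpha> s) n"
  have "(LBINT y:{0<..}. (poly ?P y)\<^sup>2 / y * weight \<alpha> s y) = (LBINT y:{0<..}. poly (?P * ?P) y * weight (\<alpha> - 1) s y)"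
    by (intro set_lebesgue_integral_cong) (auto simp: power2_eq_square simp flip: weight_divide)
  then show ?thesis
    using set_integral_poly_weight(2)[OF w(2), of "?P * ?P"] w(1)
    by (simp add: a_coeff_def sq_norm_eq orth_poly_eq)
qed

subsection \<open>Relations between the recurrence coefficients\<close>

text \<open>For each monomial this is \<open>moment_pearson\<close> at exponent r + i; the surplus i
  in the factor r + i is what \<open>pderiv p\<close> collects.\<close>

lemma moment_fun_pearson:
  assumes "s > 0"
  shows "moment_fun r s p = moment_fun r s (pderiv p) + r * moment_fun (r - 1) s p + s * moment_fun (r - 2) s p"
proof (induction p arbitrary: r)
  case (pCons a p)
  have "moment_fun r s (pCons a p) = a * (r * moment (r - 1) s + s * moment (r - 2) s) +
      (moment_fun (r + 1) s (pderiv p) + (r + 1) * moment_fun r s p + s * moment_fun (r - 1) s p)"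
    using pCons.IH[of "r + 1"] moment_pearson[OF assms, of r] by (simp add: moment_fun_pCons)
  then show ?case by (simp add: moment_fun_pCons pderiv_pCons moment_fun_add algebra_simps)
qed simp

definition coeff_a :: "real \<Rightarrow> real \<Rightarrow> nat \<Rightarrow> real" where
  "coeff_a \<alpha> s n = s * moment_fun (\<alpha> - 1) s (monic_op (moment_fun \<alpha> s) n * monic_op (moment_fun \<alpha> s) n) / norm_sq (moment_fun \<alpha> s) n"

text \<open>The value at n = 0 corresponds to the convention that the polynomial of index -1 is
  0.\<close>

definition coeff_b :: "real \<Rightarrow> real \<Rightarrow> nat \<Rightarrow> real" where
  "coeff_b \<alpha> s n = (if n = 0 then 0
     else s * moment_fun (\<alpha> - 1) s (monic_op (moment_fun \<alpha> s) n * monic_op (moment_fun \<alpha> s) (n - 1)) / norm_sq (moment_fun \<alpha> s) (n - 1))"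

text \<open>Splitting off the lowest coefficients of \<open>q\<close> leaves a polynomial quotient of \<open>q\<close> by \<open>x\<close>
  or \<open>x\<^sup>2\<close>, on which orthogonality can be used.\<close>

context
  fixes \<alpha> s :: real
  assumes s: "s > 0"
begin

private abbreviation "P \<equiv> monic_op (moment_fun \<alpha> s)"
private abbreviation "h \<equiv> norm_sq (moment_fun \<alpha> s)"

interpretation positive_functional "moment_fun \<alpha> s"
  by (rule positive_functional_moment_fun) (simp add: weight_integrable_def s)

lemma h_nonzero: "h n \<noteq> 0"
  using norm_sq_pos[of n] by simp

lemma moment_fun_minus_1:
  assumes "\<And>i. i > Suc n \<Longrightarrow> coeff q i = 0"
  shows "moment_fun (\<alpha> - 1) s (P n * q) = coeff q 0 * moment_fun (\<alpha> - 1) s (P n) + coeff q (Suc n) * h n"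
proof (cases q)
  case (pCons c q')
  have "moment_fun \<alpha> s (P n * q') = coeff q' n * h n"
    by (rule monic_op_mult) (use assms[of "Suc _"] pCons in auto)
  then show ?thesis
    unfolding pCons by (simp add: moment_fun_add moment_fun_smult moment_fun_pCons)
qed

lemma moment_fun_minus_2:
  assumes "\<And>i. i > Suc (Suc n) \<Longrightarrow> coeff q i = 0"
  shows "moment_fun (\<alpha> - 2) s (P n * q) = coeff q 0 * moment_fun (\<alpha> - 2) s (P n)
      + coeff q 1 * moment_fun (\<alpha> - 1) s (P n) + coeff q (Suc (Suc n)) * h n"
proof (cases q)
  case (pCons c q')
  have "moment_fun (\<alpha> - 1) s (P n * q') = coeff q' 0 * moment_fun (\<alpha> - 1) s (P n) + coeff q' (Suc n) * h n"
    by (rule moment_fun_minus_1) (use assms[of "Suc _"] pCons in auto)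
  then show ?thesis
    unfolding pCons by (simp add: moment_fun_add moment_fun_smult moment_fun_pCons)
qed

text \<open>Exponent \<alpha> + 1 encodes the choice f = x \<open>(P n)^2\<close> in Pearson's
  identity. The polynomial x times \<open>pderiv (P n)\<close> has top coefficient n, which produces
  the term 2n.\<close>

lemma rec_alpha_eq: "rec_alpha (moment_fun \<alpha> s) n = 2 * real n + 1 + \<alpha> + coeff_a \<alpha> s n"
proof -
  have "moment_fun (\<alpha> + 1) s (P n * P n) = 2 * moment_fun (\<alpha> + 1) s (P n * pderiv (P n)) + (\<alpha> + 1) * h n
      + s * moment_fun (\<alpha> - 1) s (P n * P n)"
    using moment_fun_pearson[OF s, of "\<alpha> + 1" "P n * P n"]
    by (simp add: pderiv_mult moment_fun_add moment_fun_double norm_sq_def mult.commute)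
  moreover have "moment_fun (\<alpha> + 1) s (P n * pderiv (P n)) = real n * h n"
  proof -
    have "moment_fun (\<alpha> + 1) s (P n * pderiv (P n)) = moment_fun \<alpha> s (P n * pCons 0 (pderiv (P n)))"
      by (simp add: moment_fun_pCons)
    also have "\<dots> = coeff (pCons 0 (pderiv (P n))) n * h n"
      by (rule monic_op_mult) (auto simp: coeff_pCons coeff_pderiv split: nat.splits)
    also have "coeff (pCons 0 (pderiv (P n))) n = real n"
      by (cases n) (auto simp: coeff_pderiv simp del: monic_op.simps)
    finally show ?thesis .
  qed
  moreover have "moment_fun (\<alpha> + 1) s (P n * P n) = rec_alpha (moment_fun \<alpha> s) n * h n"
    using h_nonzero[of n] by (simp add: rec_alpha_def moment_fun_pCons)
  ultimately have "rec_alpha (moment_fun \<alpha> s) n * h n = (2 * real n + 1 + \<alpha>) * h n + s * moment_fun (\<alpha> - 1) s (P n * P n)"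
    by (simp add: algebra_simps)
  then show ?thesis using h_nonzero[of n] by (simp add: coeff_a_def field_simps)
qed

lemma coeff_a_eq: "coeff_a \<alpha> s n = s * coeff (P n) 0 * moment_fun (\<alpha> - 1) s (P n) / h n"
  using moment_fun_minus_1[of n "P n"] by (simp add: coeff_a_def)

lemma coeff_b_Suc: "coeff_b \<alpha> s (Suc n) = s * coeff (P n) 0 * moment_fun (\<alpha> - 1) s (P (Suc n)) / h n"
  using moment_fun_minus_1[of "Suc n" "P n"] by (simp add: coeff_b_def)

text \<open>Here \<open>P (Suc n)\<close>, not \<open>P n\<close>, is the factor divided by x. Its
  quotient has degree n, so its leading coefficient contributes the extra s.\<close>

lemma coeff_b_Suc': "coeff_b \<alpha> s (Suc n) = s + s * coeff (P (Suc n)) 0 * moment_fun (\<alpha> - 1) s (P n) / h n"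
proof -
  have "moment_fun (\<alpha> - 1) s (P (Suc n) * P n) = coeff (P (Suc n)) 0 * moment_fun (\<alpha> - 1) s (P n) + h n"
    using moment_fun_minus_1[of n "P (Suc n)"] by (simp add: mult.commute del: monic_op.simps)
  then show ?thesis using h_nonzero[of n] by (simp add: coeff_b_def field_simps del: monic_op.simps)
qed

text \<open>Up to a common factor this is the three-term recurrence evaluated at x = 0.\<close>

lemma coeff_b_sum: "coeff_b \<alpha> s (Suc n) + coeff_b \<alpha> s n = s - rec_alpha (moment_fun \<alpha> s) n * coeff_a \<alpha> s n"
proof -
  let ?u = "moment_fun (\<alpha> - 1) s (P n)"
  have r: "coeff (P (Suc n)) 0 + rec_alpha (moment_fun \<alpha> s) n * coeff (P n) 0
      + rec_beta (moment_fun \<alpha> s) n * coeff (P (n - 1)) 0 = 0"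
    using arg_cong[OF monic_op_recurrence[of "moment_fun \<alpha> s" n], of "\<lambda>p. coeff p 0"] by (simp del: monic_op.simps)
  have "coeff_b \<alpha> s n = s * ?u / h n * (rec_beta (moment_fun \<alpha> s) n * coeff (P (n - 1)) 0)"
  proof (cases n)
    case (Suc m)
    then show ?thesis using h_nonzero[of m] h_nonzero[of n] coeff_b_Suc[of m]
      by (simp add: rec_beta_def field_simps del: monic_op.simps)
  qed (simp add: coeff_b_def rec_beta_def)
  then have "coeff_b \<alpha> s (Suc n) + coeff_b \<alpha> s n - (s - rec_alpha (moment_fun \<alpha> s) n * coeff_a \<alpha> s n) = s * ?u / h n *
     (coeff (P (Suc n)) 0 + rec_alpha (moment_fun \<alpha> s) n * coeff (P n) 0
      + rec_beta (moment_fun \<alpha> s) n * coeff (P (n - 1)) 0)"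
    by (simp add: coeff_b_Suc' coeff_a_eq algebra_simps del: monic_op.simps)
  then show ?thesis using r by simp
qed

text \<open>One formula for \<open>coeff_b\<close> gives the first factor, the other gives the
  second; regrouping the two constant terms and the two functionals by index produces the two values
  of \<open>coeff_a\<close>.\<close>

lemma coeff_b_product:
  "coeff_b \<alpha> s (Suc n) * (coeff_b \<alpha> s (Suc n) - s) = rec_beta (moment_fun \<alpha> s) (Suc n) * coeff_a \<alpha> s (Suc n) * coeff_a \<alpha> s n"
proof -
  have "coeff_b \<alpha> s (Suc n) * (coeff_b \<alpha> s (Suc n) - s) = (s * coeff (P n) 0 * moment_fun (\<alpha> - 1) s (P (Suc n)) / h n)
      * (s * coeff (P (Suc n)) 0 * moment_fun (\<alpha> - 1) s (P n) / h n)"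
    by (subst (2) coeff_b_Suc') (simp add: coeff_b_Suc del: monic_op.simps)
  then show ?thesis
    using h_nonzero[of n] h_nonzero[of "Suc n"]
    by (simp add: coeff_a_eq rec_beta_def field_simps del: monic_op.simps)
qed

text \<open>The four Pearson identities involve \<open>P\<^sub>n(0)\<close>, \<open>P\<^sub>n'(0)\<close> and the functionals of
  \<open>P\<^sub>n/x\<close>, \<open>P\<^sub>n/x\<^sup>2\<close>; eliminating the latter leaves two expressions for the Wronskian
  of two consecutive polynomials at the origin, and eliminating that gives the claim.\<close>

lemma beta_coeff_a_sum:
  "rec_beta (moment_fun \<alpha> s) (Suc n) * (coeff_a \<alpha> s (Suc n) + coeff_a \<alpha> s n)
    = real (Suc n) * s - (2 * real (Suc n) + \<alpha>) * coeff_b \<alpha> s (Suc n)"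
proof -
  define p p' q q' where "p = coeff (P (Suc n)) 0" "p' = coeff (P (Suc n)) 1"
    "q = coeff (P n) 0" "q' = coeff (P n) 1"
  define u v u1 v1 where "u = moment_fun (\<alpha> - 1) s (P (Suc n))" "v = moment_fun (\<alpha> - 2) s (P (Suc n))"
    "u1 = moment_fun (\<alpha> - 1) s (P n)" "v1 = moment_fun (\<alpha> - 2) s (P n)"
  note defs = p_p'_q_q'_def u_v_u1_v1_def
  define k where "k = h n"
  define hh where "hh = h (Suc n)"
  have k: "k \<noteq> 0" "hh \<noteq> 0" using h_nonzero by (auto simp: k_def hh_def)
  have pear: "moment_fun \<alpha> s (f * g) = moment_fun \<alpha> s (pderiv f * g) + moment_fun \<alpha> s (f * pderiv g)
      + \<alpha> * moment_fun (\<alpha> - 1) s (f * g) + s * moment_fun (\<alpha> - 2) s (f * g)" for f g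
    using moment_fun_pearson[OF s, of \<alpha> "f * g"] by (simp add: pderiv_mult moment_fun_add mult.commute)
  have PdP: "moment_fun \<alpha> s (P m * pderiv (P j)) = (if j = Suc m then real j * h m else 0)" if "j \<le> Suc m" for m j
    using monic_op_mult[of m "pderiv (P j)"] that by (auto simp: coeff_pderiv simp del: monic_op.simps)
  have PQ: "moment_fun \<alpha> s (P (Suc n) * P n) = 0" using monic_op_orthogonal[of "Suc n" n] by simp
  have m1: "moment_fun (\<alpha> - 1) s (P m * P m) = coeff (P m) 0 * moment_fun (\<alpha> - 1) s (P m)"
    "moment_fun (\<alpha> - 2) s (P m * P m) = coeff (P m) 0 * moment_fun (\<alpha> - 2) s (P m) + coeff (P m) 1 * moment_fun (\<alpha> - 1) s (P m)" for m
    using moment_fun_minus_1[of m "P m"] moment_fun_minus_2[of m "P m"] by (simp_all del: monic_op.simps)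
  have e1: "hh = \<alpha> * p * u + s * (p * v + p' * u)"
    using pear[of "P (Suc n)" "P (Suc n)"] PdP[of "Suc n" "Suc n"]
    by (simp add: m1 defs hh_def norm_sq_def mult.commute algebra_simps del: monic_op.simps)
  have e4: "k = \<alpha> * q * u1 + s * (q * v1 + q' * u1)"
    using pear[of "P n" "P n"] PdP[of n n]
    by (simp add: m1 defs k_def norm_sq_def mult.commute algebra_simps del: monic_op.simps)
  \<comment> \<open>The mixed identity is evaluated twice, dividing \<open>P n\<close> by powers of
    x in \<open>e2\<close> and \<open>P (Suc n)\<close> in \<open>e3\<close>; the second way has the
    additional term \<open>\<alpha> * k\<close> from the leading coefficient.\<close>
  have pPQ: "0 = real (Suc n) * k + \<alpha> * moment_fun (\<alpha> - 1) s (P (Suc n) * P n) + s * moment_fun (\<alpha> - 2) s (P (Suc n) * P n)"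
    using pear[of "P (Suc n)" "P n"] PQ PdP[of "Suc n" n] PdP[of n "Suc n"]
    by (simp add: k_def mult.commute algebra_simps del: monic_op.simps)
  have e2: "0 = real (Suc n) * k + \<alpha> * (q * u) + s * (q * v + q' * u)"
    using pPQ moment_fun_minus_1[of "Suc n" "P n"] moment_fun_minus_2[of "Suc n" "P n"]
    by (simp add: defs del: monic_op.simps)
  have e3: "0 = real (Suc n) * k + \<alpha> * (p * u1 + k) + s * (p * v1 + p' * u1)"
    using pPQ moment_fun_minus_1[of n "P (Suc n)"] moment_fun_minus_2[of n "P (Suc n)"]
    by (simp add: defs k_def mult.commute[of "P (Suc n)" "P n"] del: monic_op.simps)
  \<comment> \<open>The combination of q times \<open>e1\<close> and p times \<open>e2\<close>
    cancels \<open>v\<close>; below, p times \<open>e4\<close> and q times \<open>e3\<close> cancel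
    \<open>v1\<close>.\<close>
  have w1: "real (Suc n) * p * k + q * hh = s * u * (p' * q - p * q')"
  proof -
    have "q * hh = q * (\<alpha> * p * u + s * (p * v + p' * u))
        - p * (real (Suc n) * k + \<alpha> * (q * u) + s * (q * v + q' * u))"
      using e1 e2 by simp
    then show ?thesis by (simp add: algebra_simps)
  qed
  have w2: "(real (Suc n) + \<alpha>) * q * k + p * k = - s * u1 * (p' * q - p * q')"
  proof -
    have "p * k = p * (\<alpha> * q * u1 + s * (q * v1 + q' * u1))
        - q * (real (Suc n) * k + \<alpha> * (p * u1 + k) + s * (p * v1 + p' * u1))"
      using e3 e4 by simp
    then show ?thesis by (simp add: algebra_simps)
  qed
  have w3: "u1 * (real (Suc n) * p * k + q * hh) + u * ((real (Suc n) + \<alpha>) * q * k + p * k) = 0"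
    unfolding w1 w2 by (simp add: algebra_simps)
  have b: "coeff_b \<alpha> s (Suc n) = s * q * u / k" "coeff_b \<alpha> s (Suc n) - s = s * p * u1 / k"
    using coeff_b_Suc[of n] coeff_b_Suc'[of n] by (simp_all add: defs k_def)
  have a: "coeff_a \<alpha> s (Suc n) = s * p * u / hh" "coeff_a \<alpha> s n = s * q * u1 / k"
    using coeff_a_eq[of "Suc n"] coeff_a_eq[of n] by (simp_all add: defs k_def hh_def)
  have be: "rec_beta (moment_fun \<alpha> s) (Suc n) = hh / k" by (simp add: rec_beta_def k_def hh_def)
  have "real (Suc n) * (coeff_b \<alpha> s (Suc n) - s) + (real (Suc n) + \<alpha>) * coeff_b \<alpha> s (Suc n)
      + rec_beta (moment_fun \<alpha> s) (Suc n) * (coeff_a \<alpha> s (Suc n) + coeff_a \<alpha> s n)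
    = s / k\<^sup>2 * (u1 * (real (Suc n) * p * k + q * hh) + u * ((real (Suc n) + \<alpha>) * q * k + p * k))"
    unfolding b(2) unfolding b(1) a be using k by (simp add: field_simps power2_eq_square)
  then have "real (Suc n) * (coeff_b \<alpha> s (Suc n) - s) + (real (Suc n) + \<alpha>) * coeff_b \<alpha> s (Suc n)
      + rec_beta (moment_fun \<alpha> s) (Suc n) * (coeff_a \<alpha> s (Suc n) + coeff_a \<alpha> s n) = 0"
    unfolding w3 by simp
  then show ?thesis by (simp add: algebra_simps)
qed

end

section \<open>Second highest coefficients and the sum of the values of
  \<open>coeff_a\<close>\<close>

text \<open>The shift by \<open>pCons 0\<close> gives the coefficient of \<open>x\<^sup>n\<^sup>-\<^sup>1\<close> for \<open>n > 0\<close> and 0 for \<open>n = 0\<close>,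
  without the truncated \<open>n - 1\<close>.\<close>

definition subcoeff :: "(real poly \<Rightarrow> real) \<Rightarrow> nat \<Rightarrow> real" where
  "subcoeff L n = coeff (pCons 0 (monic_op L n)) n"

text \<open>Comparison of the coefficients of \<open>x^n\<close> in the three-term
  recurrence.\<close>

lemma subcoeff_diff: "subcoeff L n - subcoeff L (Suc n) = rec_alpha L n"
  using arg_cong[OF monic_op_recurrence[of L n], of "\<lambda>p. coeff p n"]
  by (cases n) (simp_all add: subcoeff_def rec_beta_def del: monic_op.simps)

lemma sum_rec_alpha: "(\<Sum>j<n. rec_alpha L j) = - subcoeff L n"
proof (induction n)
  case (Suc n)
  then show ?case using subcoeff_diff[of L n] by simp
qed (simp add: subcoeff_def)

text \<open>Pearson's identity for x times two consecutive polynomials, encoded again by exponent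
  \<alpha> + 1; the second highest coefficient enters through the derivative of the polynomial of
  index n.\<close>

lemma subcoeff_eq:
  assumes s: "s > 0"
  shows "- subcoeff (moment_fun \<alpha> s) n = rec_beta (moment_fun \<alpha> s) n - coeff_b \<alpha> s n"
proof (cases n)
  case 0
  then show ?thesis by (simp add: subcoeff_def rec_beta_def coeff_b_def)
next
  case (Suc m)
  interpret positive_functional "moment_fun \<alpha> s"
    by (rule positive_functional_moment_fun) (simp add: weight_integrable_def s)
  let ?P = "monic_op (moment_fun \<alpha> s)" and ?h = "norm_sq (moment_fun \<alpha> s)"
  have h: "?h m \<noteq> 0" using norm_sq_pos[of m] by simp
  have PQ: "moment_fun \<alpha> s (?P n * ?P m) = 0" using Suc by (intro monic_op_orthogonal) simp
  have "moment_fun (\<alpha> + 1) s (?P n * ?P m) = moment_fun (\<alpha> + 1) s (?P n * pderiv (?P m)) + moment_fun (\<alpha> + 1) s (?P m * pderiv (?P n))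
     + s * moment_fun (\<alpha> - 1) s (?P n * ?P m)"
    using moment_fun_pearson[OF s, of "\<alpha> + 1" "?P n * ?P m"] PQ
    by (simp add: pderiv_mult moment_fun_add mult.commute)
  moreover have "moment_fun (\<alpha> + 1) s (?P n * ?P m) = ?h n"
    using monic_op_mult[of n "pCons 0 (?P m)"] Suc
    by (simp add: moment_fun_pCons coeff_pCons split: nat.splits del: monic_op.simps)
  moreover have "moment_fun (\<alpha> + 1) s (?P n * pderiv (?P m)) = 0"
    using monic_op_mult[of n "pCons 0 (pderiv (?P m))"] Suc
    by (simp add: moment_fun_pCons coeff_pCons coeff_pderiv split: nat.splits del: monic_op.simps)
  moreover have "moment_fun (\<alpha> + 1) s (?P m * pderiv (?P n)) = - coeff (?P n) m * ?h m"
  proof -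
    \<comment> \<open>The coefficient of \<open>x^i\<close> is multiplied by i - n: the top one
      disappears and the one of index m = n - 1 changes sign, so \<open>monic_op_mult\<close>
      applies at m.\<close>
    let ?q = "pCons 0 (pderiv (?P n)) - smult (real n) (?P n)"
    have c: "coeff (pCons 0 (pderiv (?P n))) i = real i * coeff (?P n) i" for i
      by (cases i) (auto simp: coeff_pderiv)
    have "moment_fun \<alpha> s (?P m * ?q) = coeff ?q m * ?h m"
      by (rule monic_op_mult) (metis Suc Suc_lessI c coeff_diff coeff_smult coeff_monic_op_eq_0 diff_self mult_zero_right)
    also have "coeff ?q m = - coeff (?P n) m"
      unfolding coeff_diff c using Suc by (simp add: algebra_simps del: monic_op.simps)
    finally show ?thesis
      using PQ by (simp add: right_diff_distrib moment_fun_diff moment_fun_smult moment_fun_pCons mult.commute)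
  qed
  ultimately have "?h n = - coeff (?P n) m * ?h m + s * moment_fun (\<alpha> - 1) s (?P n * ?P m)" by simp
  then show ?thesis using Suc h
    by (simp add: subcoeff_def coeff_b_def rec_beta_def field_simps del: monic_op.simps)
qed

lemma sum_coeff_a:
  assumes s: "s > 0"
  shows "(\<Sum>j<n. coeff_a \<alpha> s j) = rec_beta (moment_fun \<alpha> s) n - coeff_b \<alpha> s n - real n * (real n + \<alpha>)"
proof -
  have "(\<Sum>j<n. 2 * real j + 1 + \<alpha>) = real n * (real n + \<alpha>)"
    by (induction n) (auto simp: algebra_simps)
  then show ?thesis
    using sum_rec_alpha[of "moment_fun \<alpha> s" n] subcoeff_eq[OF s, of \<alpha> n]
    by (simp add: rec_alpha_eq[OF s] sum.distrib)
qed

text \<open>Purely algebraic: \<open>a'\<close> is just a number satisfying the differential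
  relation, so everything becomes rational in s, \<alpha>, n, \<open>a\<close> and
  \<open>b\<close>.\<close>

lemma sum_coeff_a_eq_derivative_form:
  fixes n :: nat
  assumes s: "s > 0" and a': "s * a' = 2 * coeff_b \<alpha> s n - s + rec_alpha (moment_fun \<alpha> s) n * coeff_a \<alpha> s n"
    and a0: "coeff_a \<alpha> s n \<noteq> 0"
  defines "a \<equiv> coeff_a \<alpha> s n"
  shows "s / 2 - 1 / 4 * (s / a - \<alpha>)\<^sup>2 - a * (real n + \<alpha> / 2) - a\<^sup>2 / 4 + 1 / 4 * (1 - s * a' / a)\<^sup>2
    = - (\<Sum>j<n. coeff_a \<alpha> s j)"
proof -
  define b \<beta> N where "b = coeff_b \<alpha> s n" "\<beta> = rec_beta (moment_fun \<alpha> s) n" "N = real n"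
  note defs = b_\<beta>_N_def
  \<comment> \<open>The sum relation times \<open>a\<close> minus the product relation eliminates
    the value of \<open>coeff_a\<close> at n - 1. For n = 0, where that value is meaningless, both
    sides are 0.\<close>
  have quad: "\<beta> * a\<^sup>2 = a * (N * s - (2 * N + \<alpha>) * b) - b * (b - s)"
  proof (cases n)
    case 0
    then show ?thesis by (simp add: defs coeff_b_def rec_beta_def)
  next
    case (Suc m)
    have "\<beta> * (a + coeff_a \<alpha> s m) = N * s - (2 * N + \<alpha>) * b" "b * (b - s) = \<beta> * a * coeff_a \<alpha> s m"
      using beta_coeff_a_sum[OF s, of \<alpha> m] coeff_b_product[OF s, of \<alpha> m] by (simp_all add: Suc defs a_def)
    moreover have "\<beta> * a\<^sup>2 = a * (\<beta> * (a + coeff_a \<alpha> s m)) - \<beta> * a * coeff_a \<alpha> s m"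
      by (simp add: algebra_simps power2_eq_square)
    ultimately show ?thesis by simp
  qed
  have a: "a \<noteq> 0" using a0 by (simp add: a_def)
  have "s * a' = 2 * b - s + (2 * N + 1 + \<alpha> + a) * a"
    using a' by (simp add: defs a_def rec_alpha_eq[OF s])
  then have sa: "1 - s * a' / a = s / a - 2 * b / a - 2 * N - \<alpha> - a"
    using a by (simp add: field_simps power2_eq_square)
  have be: "\<beta> = (a * (N * s - (2 * N + \<alpha>) * b) - b * (b - s)) / a\<^sup>2"
    using quad a by (simp add: field_simps)
  have "s / 2 - 1 / 4 * (s / a - \<alpha>)\<^sup>2 - a * (N + \<alpha> / 2) - a\<^sup>2 / 4 + 1 / 4 * (s / a - 2 * b / a - 2 * N - \<alpha> - a)\<^sup>2
    = - (\<beta> - b - N * (N + \<alpha>))"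
    unfolding be using a by (simp add: field_simps power2_eq_square)
  then show ?thesis using sum_coeff_a[OF s, of \<alpha> n] sa by (simp add: defs)
qed

subsection \<open>Dependence on the parameter\<close>

definition has_coeff_derivative :: "(real \<Rightarrow> real poly) \<Rightarrow> real poly \<Rightarrow> real \<Rightarrow> bool" where
  "has_coeff_derivative p p' s \<longleftrightarrow>
     (\<forall>i. ((\<lambda>t. coeff (p t) i) has_real_derivative coeff p' i) (at s))"

lemma has_coeff_derivative_const: "has_coeff_derivative (\<lambda>t. p) 0 s"
  by (simp add: has_coeff_derivative_def)

lemma has_coeff_derivative_diff:
  "has_coeff_derivative p p' s \<Longrightarrow> has_coeff_derivative q q' s \<Longrightarrow> has_coeff_derivative (\<lambda>t. p t - q t) (p' - q') s"
  by (auto simp: has_coeff_derivative_def intro: DERIV_diff)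

lemma has_coeff_derivative_pCons_0:
  "has_coeff_derivative p p' s \<Longrightarrow> has_coeff_derivative (\<lambda>t. pCons 0 (p t)) (pCons 0 p') s"
  by (auto simp: has_coeff_derivative_def coeff_pCons split: nat.splits)

lemma has_coeff_derivative_mult:
  assumes "has_coeff_derivative p p' s" "has_coeff_derivative q q' s"
  shows "has_coeff_derivative (\<lambda>t. p t * q t) (p' * q s + p s * q') s"
  unfolding has_coeff_derivative_def
proof
  fix i
  have "((\<lambda>t. \<Sum>j\<le>i. coeff (p t) j * coeff (q t) (i - j)) has_real_derivative
      (\<Sum>j\<le>i. coeff (p s) j * coeff q' (i - j) + coeff p' j * coeff (q s) (i - j))) (at s)"
    using assms unfolding has_coeff_derivative_def by (intro DERIV_sum DERIV_mult') auto
  then show "((\<lambda>t. coeff (p t * q t) i) has_real_derivative coeff (p' * q s + p s * q') i) (at s)"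
    by (simp add: coeff_mult sum.distrib add.commute)
qed

lemma has_coeff_derivative_smult:
  assumes "(c has_real_derivative c') (at s)" "has_coeff_derivative p p' s"
  shows "has_coeff_derivative (\<lambda>t. smult (c t) (p t)) (smult c' (p s) + smult (c s) p') s"
  using assms unfolding has_coeff_derivative_def by (auto intro!: derivative_eq_intros)

text \<open>Serves to show that the parameter derivative of a monic polynomial has smaller degree,
  which is what orthogonality requires.\<close>

lemma has_coeff_derivative_coeff_const:
  assumes "has_coeff_derivative p p' s" "\<And>t. coeff (p t) i = c"
  shows "coeff p' i = 0"
proof -
  have "((\<lambda>t. c) has_real_derivative coeff p' i) (at s)"
  proof -
    have "(\<lambda>t. coeff (p t) i) = (\<lambda>t. c)" using assms(2) by auto
    then show ?thesis using assms(1) unfolding has_coeff_derivative_def by metis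
  qed
  then show ?thesis using DERIV_const by (rule DERIV_unique)
qed

text \<open>The bound \<open>N\<close> independent of t turns the functional into a sum over a fixed
  range. Differentiating the moments lowers \<open>r\<close> by 1, since the weight has s-derivative
  -w/x.\<close>

lemma has_real_derivative_moment_fun:
  assumes s: "s > 0" and p: "has_coeff_derivative p p' s" and deg: "\<And>t. degree (p t) \<le> N"
  shows "((\<lambda>t. moment_fun r t (p t)) has_real_derivative moment_fun r s p' - moment_fun (r - 1) s (p s)) (at s)"
proof -
  have deg': "degree p' \<le> N"
  proof (rule degree_le, intro allI impI)
    fix i assume "i > N"
    then show "coeff p' i = 0"
      by (intro has_coeff_derivative_coeff_const[OF p, where c = 0] coeff_eq_0 le_less_trans[OF deg])
  qed
  have "((\<lambda>t. \<Sum>i\<le>N. coeff (p t) i * moment (r + real i) t) has_real_derivative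
     (\<Sum>i\<le>N. coeff p' i * moment (r + real i) s + (- moment (r + real i - 1) s) * coeff (p s) i)) (at s)"
    using p has_real_derivative_moment[OF s]
    unfolding has_coeff_derivative_def by (intro DERIV_sum DERIV_mult) auto
  also have "(\<Sum>i\<le>N. coeff p' i * moment (r + real i) s + (- moment (r + real i - 1) s) * coeff (p s) i)
      = moment_fun r s p' - moment_fun (r - 1) s (p s)"
    unfolding moment_fun_eq_sum[OF deg'] moment_fun_eq_sum[OF deg] by (simp add: sum_subtractf algebra_simps)
  finally show ?thesis unfolding moment_fun_eq_sum[OF deg] .
qed

text \<open>Induction along the recurrence, whose denominators are positive norms. Existence of the
  derivative suffices: later lemmas extract its values from orthogonality.\<close>

lemma monic_op_has_coeff_derivative:
  assumes s: "s > 0"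
  obtains D where "has_coeff_derivative (\<lambda>t. monic_op (moment_fun \<alpha> t) n) D s"
proof -
  interpret positive_functional "moment_fun \<alpha> s"
    by (rule positive_functional_moment_fun) (simp add: weight_integrable_def s)
  have "\<exists>D. has_coeff_derivative (\<lambda>t. monic_op (moment_fun \<alpha> t) n) D s"
  proof (induction n rule: less_induct)
    case (less n)
    show ?case
    proof (cases n)
      case 0
      then show ?thesis using has_coeff_derivative_const by auto
    next
      case (Suc m)
      obtain D1 where D1: "has_coeff_derivative (\<lambda>t. monic_op (moment_fun \<alpha> t) m) D1 s" using less[of m] Suc by auto
      have "m - 1 < n" using Suc by linarith
      then obtain D2 where D2: "has_coeff_derivative (\<lambda>t. monic_op (moment_fun \<alpha> t) (m - 1)) D2 s" using less by blast
      have d: "degree (monic_op (moment_fun \<alpha> t) i * monic_op (moment_fun \<alpha> t) i) \<le> Suc (i + i)"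
         "degree (pCons 0 (monic_op (moment_fun \<alpha> t) i * monic_op (moment_fun \<alpha> t) i)) \<le> Suc (i + i)" for i t
        by (simp_all add: degree_mult_eq)
      note sq = has_coeff_derivative_mult[OF D1 D1] has_coeff_derivative_mult[OF D2 D2]
      obtain x1 where x1: "((\<lambda>t. moment_fun \<alpha> t (pCons 0 (monic_op (moment_fun \<alpha> t) m * monic_op (moment_fun \<alpha> t) m))) has_real_derivative x1) (at s)"
        using has_real_derivative_moment_fun[OF s has_coeff_derivative_pCons_0[OF sq(1)] d(2)] by blast
      obtain x2 where x2: "((\<lambda>t. norm_sq (moment_fun \<alpha> t) m) has_real_derivative x2) (at s)"
        using has_real_derivative_moment_fun[OF s sq(1) d(1)] unfolding norm_sq_def by blast
      obtain x3 where x3: "((\<lambda>t. norm_sq (moment_fun \<alpha> t) (m - 1)) has_real_derivative x3) (at s)"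
        using has_real_derivative_moment_fun[OF s sq(2) d(1)] unfolding norm_sq_def by blast
      have h: "norm_sq (moment_fun \<alpha> s) i \<noteq> 0" for i using norm_sq_pos[of i] by simp
      obtain y1 where y1: "((\<lambda>t. rec_alpha (moment_fun \<alpha> t) m) has_real_derivative y1) (at s)"
        using DERIV_divide[OF x1 x2 h] unfolding rec_alpha_def by blast
      obtain y2 where y2: "((\<lambda>t. rec_beta (moment_fun \<alpha> t) m) has_real_derivative y2) (at s)"
      proof (cases "m = 0")
        case True
        then have "((\<lambda>t. rec_beta (moment_fun \<alpha> t) m) has_real_derivative 0) (at s)" by (simp add: rec_beta_def)
        then show ?thesis by (rule that)
      next
        case False
        then have "((\<lambda>t. norm_sq (moment_fun \<alpha> t) m / norm_sq (moment_fun \<alpha> t) (m - 1)) = (\<lambda>t. rec_beta (moment_fun \<alpha> t) m))"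
          by (simp add: rec_beta_def)
        then show ?thesis using DERIV_divide[OF x2 x3 h] that by metis
      qed
      have "monic_op L n = pCons 0 (monic_op L m) - smult (rec_alpha L m) (monic_op L m) - smult (rec_beta L m) (monic_op L (m - 1))" for L
        using monic_op_recurrence[of L m] Suc by (simp add: algebra_simps)
      then show ?thesis
        using has_coeff_derivative_diff[OF has_coeff_derivative_diff[OF has_coeff_derivative_pCons_0[OF D1]
           has_coeff_derivative_smult[OF y1 D1]] has_coeff_derivative_smult[OF y2 D2]]
        by auto
    qed
  qed
  then show thesis using that by blast
qed

text \<open>The derivative of the polynomial has degree below n, so it is orthogonal to the
  polynomial and only the derivative of the weight contributes.\<close>

lemma has_real_derivative_norm_sq:
  assumes s: "s > 0"
  shows "((\<lambda>t. norm_sq (moment_fun \<alpha> t) n) has_real_derivative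
      - moment_fun (\<alpha> - 1) s (monic_op (moment_fun \<alpha> s) n * monic_op (moment_fun \<alpha> s) n)) (at s)"
proof -
  interpret positive_functional "moment_fun \<alpha> s"
    by (rule positive_functional_moment_fun) (simp add: weight_integrable_def s)
  obtain D where D: "has_coeff_derivative (\<lambda>t. monic_op (moment_fun \<alpha> t) n) D s"
    using monic_op_has_coeff_derivative[OF s] by blast
  have c: "coeff D i = 0" if "i \<ge> n" for i
    by (rule has_coeff_derivative_coeff_const[OF D, where c = "if i = n then 1 else 0"]) (use that in auto)
  have z: "moment_fun \<alpha> s (monic_op (moment_fun \<alpha> s) n * D) = 0"
    using monic_op_mult[of n D] c by simp
  show ?thesis
    using has_real_derivative_moment_fun[OF s has_coeff_derivative_mult[OF D D], of "n + n" \<alpha>] z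
    by (simp add: norm_sq_def moment_fun_add moment_fun_double mult.commute degree_mult_eq)
qed

text \<open>Differentiating the orthogonality of indices n and m = n - 1: the derivative
  \<open>E\<close> of the lower polynomial contributes nothing, while \<open>D\<close> contributes
  its coefficient of index m times a norm. That coefficient is the derivative sought.\<close>

lemma has_real_derivative_subcoeff:
  assumes s: "s > 0"
  shows "((\<lambda>t. subcoeff (moment_fun \<alpha> t) n) has_real_derivative coeff_b \<alpha> s n / s) (at s)"
proof (cases n)
  case 0
  then show ?thesis by (simp add: subcoeff_def coeff_b_def)
next
  case (Suc m)
  interpret positive_functional "moment_fun \<alpha> s"
    by (rule positive_functional_moment_fun) (simp add: weight_integrable_def s)
  let ?P = "\<lambda>n t. monic_op (moment_fun \<alpha> t) n"
  obtain D where D: "has_coeff_derivative (?P n) D s"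
    using monic_op_has_coeff_derivative[OF s] by blast
  obtain E where E: "has_coeff_derivative (?P m) E s"
    using monic_op_has_coeff_derivative[OF s] by blast
  have cD: "coeff D i = 0" if "i > m" for i
    by (rule has_coeff_derivative_coeff_const[OF D, where c = "if i = n then 1 else 0"])
      (use that Suc in \<open>auto simp del: monic_op.simps\<close>)
  have cE: "coeff E i = 0" if "i \<ge> m" for i
    by (rule has_coeff_derivative_coeff_const[OF E, where c = "if i = m then 1 else 0"]) (use that in auto)
  have z: "moment_fun \<alpha> s (?P m s * D) = coeff D m * norm_sq (moment_fun \<alpha> s) m" "moment_fun \<alpha> s (?P n s * E) = 0"
    using monic_op_mult[of m D] monic_op_mult[of n E] cD cE Suc by auto
  have "((\<lambda>t. moment_fun \<alpha> t (?P n t * ?P m t)) has_real_derivative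
      moment_fun \<alpha> s (D * ?P m s + ?P n s * E) - moment_fun (\<alpha> - 1) s (?P n s * ?P m s)) (at s)"
    by (rule has_real_derivative_moment_fun[OF s has_coeff_derivative_mult[OF D E], of "n + m"])
      (simp add: degree_mult_eq)
  moreover have "((\<lambda>t. moment_fun \<alpha> t (?P n t * ?P m t)) has_real_derivative 0) (at s)"
  proof (rule has_field_derivative_transform_within_open[OF DERIV_const])
    show "open {0::real<..}" "s \<in> {0<..}" using s by auto
    fix t :: real assume "t \<in> {0<..}"
    then interpret t: positive_functional "moment_fun \<alpha> t"
      by (intro positive_functional_moment_fun) (simp add: weight_integrable_def)
    show "0 = moment_fun \<alpha> t (?P n t * ?P m t)" using t.monic_op_orthogonal[of n m] Suc by simp
  qed
  ultimately have "moment_fun \<alpha> s (D * ?P m s + ?P n s * E) - moment_fun (\<alpha> - 1) s (?P n s * ?P m s) = 0"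
    by (rule DERIV_unique)
  then have "coeff D m * norm_sq (moment_fun \<alpha> s) m = moment_fun (\<alpha> - 1) s (?P n s * ?P m s)"
    using z by (simp add: moment_fun_add mult.commute)
  then have "coeff D m = coeff_b \<alpha> s n / s"
    using s Suc norm_sq_pos[of m] by (simp add: coeff_b_def field_simps del: monic_op.simps)
  moreover have "((\<lambda>t. coeff (?P n t) m) has_real_derivative coeff D m) (at s)"
    using D by (simp add: has_coeff_derivative_def)
  ultimately show ?thesis using Suc by (simp add: subcoeff_def del: monic_op.simps)
qed

text \<open>By \<open>rec_alpha_eq\<close> and \<open>subcoeff_diff\<close>, \<open>coeff_a\<close>
  is a difference of two second highest coefficients up to a constant; \<open>coeff_b_sum\<close>
  then removes the index n + 1.\<close>

lemma has_real_derivative_coeff_a: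
  assumes s: "s > 0"
  obtains a' where "((\<lambda>t. coeff_a \<alpha> t n) has_real_derivative a') (at s)"
    "s * a' = 2 * coeff_b \<alpha> s n - s + rec_alpha (moment_fun \<alpha> s) n * coeff_a \<alpha> s n"
proof
  let ?a = "(coeff_b \<alpha> s n / s - coeff_b \<alpha> s (Suc n) / s)"
  have "((\<lambda>t. subcoeff (moment_fun \<alpha> t) n - subcoeff (moment_fun \<alpha> t) (Suc n) - (2 * real n + 1 + \<alpha>)) has_real_derivative ?a - 0) (at s)"
    by (intro DERIV_diff has_real_derivative_subcoeff[OF s] DERIV_const)
  from has_field_derivative_transform_within_open[OF this, of "{0<..}"]
  show "((\<lambda>t. coeff_a \<alpha> t n) has_real_derivative ?a) (at s)"
    using s by (simp add: rec_alpha_eq subcoeff_diff)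
  show "s * ?a = 2 * coeff_b \<alpha> s n - s + rec_alpha (moment_fun \<alpha> s) n * coeff_a \<alpha> s n"
  proof -
    have "s * ?a = coeff_b \<alpha> s n - coeff_b \<alpha> s (Suc n)" using s by (simp add: field_simps)
    then show ?thesis using coeff_b_sum[OF s, of \<alpha> n] by simp
  qed
qed

lemma coeff_a_pos:
  assumes "s > 0" shows "coeff_a \<alpha> s n > 0"
proof -
  interpret positive_functional "moment_fun \<alpha> s"
    by (rule positive_functional_moment_fun) (simp add: weight_integrable_def assms)
  show ?thesis unfolding coeff_a_def
    using assms by (intro divide_pos_pos mult_pos_pos norm_sq_pos moment_fun_square_pos) (auto simp: weight_integrable_def)
qed

lemma a_coeff_eq_coeff_a: "s > 0 \<Longrightarrow> a_coeff \<alpha> n s = coeff_a \<alpha> s n"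
  by (simp add: a_coeff_eq coeff_a_def)

subsection \<open>The Hankel determinant\<close>

lemma hankel_det_eq_moments:
  "hankel_det \<alpha> n s = Determinant.det (Matrix.mat n n (\<lambda>(j, k). moment (\<alpha> + real (j + k)) s))"
proof -
  have "(LBINT x:{0<..}. x ^ k * weight \<alpha> s x) = moment (\<alpha> + real k) s" for k
    unfolding moment_def by (intro set_lebesgue_integral_cong) (auto simp: power_mult_weight)
  then show ?thesis by (simp add: hankel_det_def)
qed

lemma moment_fun_mult_monom: "moment_fun r s (p * monom 1 k) = moment_fun (r + real k) s p"
proof (induction k arbitrary: r)
  case (Suc k)
  then show ?case by (simp add: monom_Suc moment_fun_pCons add_ac)
qed (simp add: monom_0)

text \<open>Multiplying the moment matrix on the left by the coefficient matrix \<open>C\<close>,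
  unit lower triangular, replaces monomials by orthogonal polynomials in the rows. The product
  \<open>B\<close> is upper triangular with the norms on the diagonal.\<close>

lemma hankel_det_eq_prod:
  assumes "weight_integrable \<alpha> s"
  shows "hankel_det \<alpha> n s = (\<Prod>j<n. norm_sq (moment_fun \<alpha> s) j)"
proof -
  interpret positive_functional "moment_fun \<alpha> s" by (rule positive_functional_moment_fun[OF assms])
  let ?P = "monic_op (moment_fun \<alpha> s)"
  define H where "H = Matrix.mat n n (\<lambda>(j, k). moment (\<alpha> + real (j + k)) s)"
  define C where "C = Matrix.mat n n (\<lambda>(i, j). coeff (?P i) j)"
  define B where "B = Matrix.mat n n (\<lambda>(i, k). moment_fun \<alpha> s (?P i * monom 1 k))"
  have c: "H \<in> carrier_mat n n" "C \<in> carrier_mat n n" "B \<in> carrier_mat n n"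
    by (simp_all add: H_def C_def B_def)
  have "C * H = B"
  proof (rule eq_matI)
    fix i k assume "i < dim_row B" "k < dim_col B"
    then have ik: "i < n" "k < n" by (simp_all add: B_def)
    have "(C * H) $$ (i, k) = (\<Sum>j = 0..<n. coeff (?P i) j * moment (\<alpha> + real (j + k)) s)"
      using ik by (simp add: C_def H_def scalar_prod_def)
    also have "\<dots> = (\<Sum>j\<le>i. coeff (?P i) j * moment (\<alpha> + real (j + k)) s)"
      by (rule sum.mono_neutral_right) (use ik in auto)
    also have "\<dots> = moment_fun (\<alpha> + real k) s (?P i)"
      by (simp add: moment_fun_def add_ac)
    also have "\<dots> = B $$ (i, k)"
      using ik by (simp add: B_def moment_fun_mult_monom)
    finally show "(C * H) $$ (i, k) = B $$ (i, k)" .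
  qed (simp_all add: B_def C_def H_def)
  moreover have "Determinant.det C = 1"
    by (subst det_lower_triangular[OF _ c(2)]) (auto simp: C_def prod_list_diag_prod)
  moreover have "Determinant.det B = (\<Prod>j<n. norm_sq (moment_fun \<alpha> s) j)"
  proof -
    have entry: "moment_fun \<alpha> s (?P i * monom 1 k) = (if k = i then norm_sq (moment_fun \<alpha> s) i else 0)" if "k \<le> i" for i k
      using monic_op_mult[of i "monom 1 k"] that by (auto simp: coeff_monom)
    have "upper_triangular B" unfolding upper_triangular_def by (auto simp: B_def entry)
    then show ?thesis
      by (subst det_upper_triangular[OF _ c(3)]) (auto simp: B_def prod_list_diag_prod entry atLeast0LessThan)
  qed
  ultimately show ?thesis
    using det_mult[OF c(2,1)] by (simp add: hankel_det_eq_moments H_def)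
qed

lemma hankel_det_pos: "weight_integrable \<alpha> s \<Longrightarrow> hankel_det \<alpha> n s > 0"
  by (simp add: hankel_det_eq_prod prod_pos positive_functional.norm_sq_pos positive_functional_moment_fun)

text \<open>The Leibniz expansion reduces this to moments of exponent at least \<alpha>, for which
  \<open>moment_tendsto_0\<close> holds.\<close>

lemma hankel_det_tendsto_0:
  assumes "\<alpha> > 0"
  shows "((\<lambda>t. hankel_det \<alpha> n t) \<longlongrightarrow> hankel_det \<alpha> n 0) (at_right 0)"
proof -
  have "((\<lambda>t. \<Sum>p\<in>{p. p permutes {0..<n}}. signof p * (\<Prod>i = 0..<n. moment (\<alpha> + real (i + p i)) t)) \<longlongrightarrow>
      (\<Sum>p\<in>{p. p permutes {0..<n}}. signof p * (\<Prod>i = 0..<n. moment (\<alpha> + real (i + p i)) 0))) (at_right 0)"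
    using assms by (intro tendsto_sum tendsto_mult tendsto_prod tendsto_const moment_tendsto_0 add_pos_nonneg) auto
  moreover have "hankel_det \<alpha> n t =
      (\<Sum>p\<in>{p. p permutes {0..<n}}. signof p * (\<Prod>i = 0..<n. moment (\<alpha> + real (i + p i)) t))" for t
  proof -
    have "p i < n" if "p permutes {0..<n}" "i < n" for p i
      using permutes_in_image[OF that(1), of i] that(2) by simp
    then show ?thesis
      unfolding hankel_det_eq_moments Determinant.det_def by (auto intro!: sum.cong prod.cong)
  qed
  ultimately show ?thesis by simp
qed

text \<open>The sign is chosen to make the derivative nonnegative, as the fundamental theorem of
  calculus for nonnegative integrands demands.\<close>

lemma has_real_derivative_minus_ln_hankel_det:
  assumes s: "s > 0"
  shows "((\<lambda>t. - ln (hankel_det \<alpha> n t)) has_real_derivative (\<Sum>j<n. coeff_a \<alpha> s j) / s) (at s)"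
proof -
  have hp: "norm_sq (moment_fun \<alpha> t) j > 0" if "t > 0" for t j
    using that by (intro positive_functional.norm_sq_pos positive_functional_moment_fun) (simp add: weight_integrable_def)
  have der: "((\<lambda>t. - (\<Sum>j<n. ln (norm_sq (moment_fun \<alpha> t) j))) has_real_derivative
      - (\<Sum>j<n. 1 / norm_sq (moment_fun \<alpha> s) j * - moment_fun (\<alpha> - 1) s (monic_op (moment_fun \<alpha> s) j * monic_op (moment_fun \<alpha> s) j))) (at s)"
    by (intro DERIV_minus DERIV_sum DERIV_chain2[OF DERIV_ln_divide] has_real_derivative_norm_sq hp s)
  have eq: "- (\<Sum>j<n. 1 / norm_sq (moment_fun \<alpha> s) j * - moment_fun (\<alpha> - 1) s (monic_op (moment_fun \<alpha> s) j * monic_op (moment_fun \<alpha> s) j))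
      = (\<Sum>j<n. coeff_a \<alpha> s j) / s"
    using s by (simp add: coeff_a_def sum_negf sum_divide_distrib)
  have ln: "- ln (hankel_det \<alpha> n t) = - (\<Sum>j<n. ln (norm_sq (moment_fun \<alpha> t) j))" if "t > 0" for t
    using that hp[OF that] by (simp add: hankel_det_eq_prod weight_integrable_def ln_prod less_imp_neq[THEN not_sym])
  show ?thesis
    by (rule has_field_derivative_transform_within_open[OF der[unfolded eq], of "{0<..}"])
      (use s ln in simp_all)
qed

section \<open>Integration from 0 to s\<close>

theorem theorem2:
  fixes \<alpha> s :: real and n :: nat
  assumes "\<alpha> > 0" and "s > 0"
  shows
    "(\<forall>t>0. a_coeff \<alpha> n differentiable (at t) \<and> X_fun \<alpha> n differentiable (at t)) \<and>
     interval_lebesgue_integrable lborel 0 (ereal s)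
       (\<lambda>t. (t / 2 - 1 / 4 * (t / a_coeff \<alpha> n t - \<alpha>)\<^sup>2 - a_coeff \<alpha> n t * (real n + \<alpha> / 2)
             - (a_coeff \<alpha> n t)\<^sup>2 / 4
             + 1 / 4 * (1 - t * deriv (a_coeff \<alpha> n) t / a_coeff \<alpha> n t)\<^sup>2) / t) \<and>
     interval_lebesgue_integrable lborel 0 (ereal s)
       (\<lambda>t. (t / 2 - 1 / 4 * (X_fun \<alpha> n t - \<alpha>)\<^sup>2 - (real n + \<alpha> / 2) * (t / X_fun \<alpha> n t)
             - t\<^sup>2 / (4 * (X_fun \<alpha> n t)\<^sup>2)
             + t\<^sup>2 * (deriv (X_fun \<alpha> n) t)\<^sup>2 / (4 * (X_fun \<alpha> n t)\<^sup>2)) / t) \<and>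
     ln (hankel_det \<alpha> n s / hankel_det \<alpha> n 0) =
       (LBINT t=0..ereal s.
            (t / 2 - 1 / 4 * (t / a_coeff \<alpha> n t - \<alpha>)\<^sup>2 - a_coeff \<alpha> n t * (real n + \<alpha> / 2)
             - (a_coeff \<alpha> n t)\<^sup>2 / 4
             + 1 / 4 * (1 - t * deriv (a_coeff \<alpha> n) t / a_coeff \<alpha> n t)\<^sup>2) / t) \<and>
     ln (hankel_det \<alpha> n s / hankel_det \<alpha> n 0) =
       (LBINT t=0..ereal s.
            (t / 2 - 1 / 4 * (X_fun \<alpha> n t - \<alpha>)\<^sup>2 - (real n + \<alpha> / 2) * (t / X_fun \<alpha> n t)
             - t\<^sup>2 / (4 * (X_fun \<alpha> n t)\<^sup>2)
             + t\<^sup>2 * (deriv (X_fun \<alpha> n) t)\<^sup>2 / (4 * (X_fun \<alpha> n t)\<^sup>2)) / t)"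
  (is "_ \<and> interval_lebesgue_integrable _ _ _ ?f \<and> interval_lebesgue_integrable _ _ _ ?g \<and> _")
proof -
  let ?a = "a_coeff \<alpha> n" and ?X = "X_fun \<alpha> n"
  define g where "g t = (\<Sum>j<n. coeff_a \<alpha> t j) / t" for t
  have key: "?a differentiable (at t) \<and> ?X differentiable (at t) \<and> ?f t = - g t \<and> ?g t = - g t" if t: "t > 0" for t
  proof -
    obtain a' where a': "((\<lambda>t. coeff_a \<alpha> t n) has_real_derivative a') (at t)"
      "t * a' = 2 * coeff_b \<alpha> t n - t + rec_alpha (moment_fun \<alpha> t) n * coeff_a \<alpha> t n"
      using has_real_derivative_coeff_a[OF t] by blast
    have at: "?a t > 0" using coeff_a_pos[OF t] t by (simp add: a_coeff_eq_coeff_a)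
    have da: "(?a has_real_derivative a') (at t)"
      by (rule has_field_derivative_transform_within_open[OF a'(1), of "{0<..}"])
        (use t in \<open>simp_all add: a_coeff_eq_coeff_a\<close>)
    have dX: "(?X has_real_derivative (1 * ?a t - t * a') / (?a t * ?a t)) (at t)"
      unfolding X_fun_def[abs_def] by (rule DERIV_divide[OF DERIV_ident da]) (use at in simp)
    have num: "t / 2 - 1 / 4 * (t / ?a t - \<alpha>)\<^sup>2 - ?a t * (real n + \<alpha> / 2)
             - (?a t)\<^sup>2 / 4 + 1 / 4 * (1 - t * a' / ?a t)\<^sup>2 = - (\<Sum>j<n. coeff_a \<alpha> t j)"
      unfolding a_coeff_eq_coeff_a[OF t]
      by (rule sum_coeff_a_eq_derivative_form[OF t a'(2)]) (use coeff_a_pos[OF t] in \<open>simp add: less_imp_neq[THEN not_sym]\<close>)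
    have f: "?f t = - g t"
      unfolding DERIV_imp_deriv[OF da] num g_def by simp
    \<comment> \<open>Logarithmic differentiation of \<open>t / a\<close>: the quantity t X'/X
      equals 1 - t a'/a.\<close>
    have q: "t\<^sup>2 * (deriv ?X t)\<^sup>2 / (4 * (?X t)\<^sup>2) = 1 / 4 * (1 - t * a' / ?a t)\<^sup>2"
    proof -
      have "t * deriv ?X t / ?X t = 1 - t * a' / ?a t"
        unfolding DERIV_imp_deriv[OF dX] X_fun_def using at t by (simp add: field_simps)
      then have "(t * deriv ?X t / ?X t)\<^sup>2 = (1 - t * a' / ?a t)\<^sup>2" by simp
      then show ?thesis by (simp add: power_divide power_mult_distrib)
    qed
    have X: "t / ?X t = ?a t" "t\<^sup>2 / (4 * (?X t)\<^sup>2) = (?a t)\<^sup>2 / 4"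
      using at t by (simp_all add: X_fun_def power_divide)
    have "t / 2 - 1 / 4 * (?X t - \<alpha>)\<^sup>2 - (real n + \<alpha> / 2) * (t / ?X t)
             - t\<^sup>2 / (4 * (?X t)\<^sup>2) + t\<^sup>2 * (deriv ?X t)\<^sup>2 / (4 * (?X t)\<^sup>2) = - (\<Sum>j<n. coeff_a \<alpha> t j)"
      unfolding q X num[symmetric] by (simp add: X_fun_def mult.commute)
    then have "?g t = - g t" by (simp only: g_def minus_divide_left)
    moreover have "?a differentiable (at t)" "?X differentiable (at t)"
      using da dX by (auto simp: real_differentiable_def)
    ultimately show ?thesis using f by blast
  qed
  \<comment> \<open>The nonnegativity of \<open>g\<close> and the finite limit of the antiderivative
    at 0 give integrability up to the end point together with the value of the integral.\<close>
  have g: "set_integrable lborel (einterval 0 (ereal s)) g"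
    "(LBINT t=0..ereal s. g t) = - ln (hankel_det \<alpha> n s) - - ln (hankel_det \<alpha> n 0)"
  proof -
    let ?F = "\<lambda>t. - ln (hankel_det \<alpha> n t)"
    have der: "(?F has_real_derivative g t) (at t)" if "0 < ereal t" for t
      using has_real_derivative_minus_ln_hankel_det that by (simp add: g_def zero_ereal_def)
    have cont: "isCont g t" if "0 < ereal t" for t
    proof -
      have t: "t > 0" using that by (simp add: zero_ereal_def)
      have "isCont (\<lambda>t. coeff_a \<alpha> t j) t" for j
        using has_real_derivative_coeff_a[OF t] DERIV_isCont by metis
      then show ?thesis unfolding g_def[abs_def] using t by (intro continuous_intros) auto
    qed
    have nn: "AE t in lborel. 0 < ereal t \<longrightarrow> ereal t < ereal s \<longrightarrow> 0 \<le> g t"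
      unfolding g_def by (auto intro!: divide_nonneg_pos sum_nonneg less_imp_le[OF coeff_a_pos] simp: zero_ereal_def)
    have A: "((?F \<circ> real_of_ereal) \<longlongrightarrow> - ln (hankel_det \<alpha> n 0)) (at_right 0)"
      unfolding zero_ereal_def ereal_tendsto_simps
      using hankel_det_pos[of \<alpha> 0 n] assms
      by (intro tendsto_minus tendsto_ln hankel_det_tendsto_0) (auto simp: weight_integrable_def)
    have "isCont ?F s" using DERIV_isCont[OF der[of s]] assms by (simp add: zero_ereal_def)
    then have B: "((?F \<circ> real_of_ereal) \<longlongrightarrow> ?F s) (at_left (ereal s))"
      unfolding ereal_tendsto_simps isCont_def by (rule tendsto_within_subset[where S = UNIV]) simp
    have lt: "0 < ereal s" using assms by (simp add: zero_ereal_def)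
    show "set_integrable lborel (einterval 0 (ereal s)) g"
      "(LBINT t=0..ereal s. g t) = - ln (hankel_det \<alpha> n s) - - ln (hankel_det \<alpha> n 0)"
      using interval_integral_FTC_nonneg[OF lt der cont nn A B] by auto
  qed
  have lt: "0 < ereal s" using assms by (simp add: zero_ereal_def)
  have pos: "t > 0" if "t \<in> einterval 0 (ereal s)" for t
    using that by (auto simp: einterval_def zero_ereal_def)
  \<comment> \<open>Both integrands equal \<open>- g\<close> for t > 0, so one argument serves both;
    their values at t = 0 lie outside the open interval.\<close>
  have transfer: "interval_lebesgue_integrable lborel 0 (ereal s) f \<and>
      ln (hankel_det \<alpha> n s / hankel_det \<alpha> n 0) = (LBINT t=0..ereal s. f t)"
    if f: "\<And>t. t > 0 \<Longrightarrow> f t = - g t" for f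
  proof
    have "set_integrable lborel (einterval 0 (ereal s)) (\<lambda>t. - g t)"
      using set_integrable_mult_right[OF g(1), of "-1"] by simp
    then show "interval_lebesgue_integrable lborel 0 (ereal s) f"
      unfolding interval_lebesgue_integrable_def using lt f pos
      by (simp add: less_imp_le cong: set_integrable_cong)
    have "(LBINT t=0..ereal s. f t) = (LBINT t=0..ereal s. - g t)"
      by (rule interval_integral_cong) (use f pos lt in \<open>simp add: less_imp_le min_def max_def\<close>)
    also have "\<dots> = ln (hankel_det \<alpha> n s) - ln (hankel_det \<alpha> n 0)"
      using g(2) by (simp add: interval_lebesgue_integral_uminus)
    also have "\<dots> = ln (hankel_det \<alpha> n s / hankel_det \<alpha> n 0)"
      using hankel_det_pos[of \<alpha> s n] hankel_det_pos[of \<alpha> 0 n] assms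
      by (simp add: ln_div weight_integrable_def)
    finally show "ln (hankel_det \<alpha> n s / hankel_det \<alpha> n 0) = (LBINT t=0..ereal s. f t)" by simp
  qed
  show ?thesis
    using transfer[of ?f] transfer[of ?g] key by blast
qed

end
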